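(* Assume the following statement (P) holds: for all $N,M\ge1$, all domains $D\subset\mathbb{C}^N$, $G\subset\mathbb{C}^M$, and every family $\mathcal{U}$ of (not necessarily continuous) plurisubharmonic functions on $D\times G$ such that $\mathcal{U}$ is locally uniformly bounded above on $D\times\{w\}$ for each $w\in G$ and on $\{z\}\times G$ for each $z\in D$, the family $\mathcal{U}$ is locally uniformly bounded above on $D\times G$. Let $\Omega$ be an open subset of $\mathbb{C}^N$ and let $u:\Omega\to[-\infty,\infty)$ be a function such that $u|_{\Omega\cap L}$ is subharmonic for each complex line $L$. Define \[ s(z):=\sup\{v(z): v\text{ plurisubharmonic on }\Omega,\ v\le u\}. \] Then $s$ is plurisubharmonic on $\Omega$.
   Context: A domain is a connected open set. A function $u:\Omega\to[-\infty,\infty)$ on an open set $\Omega\subset\mathbb{C}^N$ is plurisubharmonic if it is upper semicontinuous and its restriction to $\Omega\cap L$ is subharmonic for every complex line $L$. A family $\mathcal{U}$ is locally uniformly bounded above on a set $S$ if for every compact subset $C$ of $S$ there is a constant $c$ with $u\le c$ on $C$ for all $u\in\mathcal{U}$. *)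

theory Defs
  imports "HOL-Analysis.Analysis"
begin

text \<open>C^N is represented as the functions nat => complex vanishing from index N on,
  carrying the (product = Euclidean) topology of nat => complex.\<close>
definition cspace :: "nat \<Rightarrow> (nat \<Rightarrow> complex) set" where
  "cspace N = {z. \<forall>i\<ge>N. z i = 0}"

definition copen :: "nat \<Rightarrow> (nat \<Rightarrow> complex) set \<Rightarrow> bool" where
  "copen N S \<longleftrightarrow> S \<subseteq> cspace N \<and> openin (top_of_set (cspace N)) S"

definition cdomain :: "nat \<Rightarrow> (nat \<Rightarrow> complex) set \<Rightarrow> bool" where
  "cdomain N D \<longleftrightarrow> copen N D \<and> connected D"

definition usc_on :: "'a::topological_space set \<Rightarrow> ('a \<Rightarrow> ereal) \<Rightarrow> bool" where
  "usc_on S f \<longleftrightarrow> (\<forall>x\<in>S. \<forall>c. f x < c \<longrightarrow> (\<exists>T. open T \<and> x \<in> T \<and> (\<forall>y\<in>S \<inter> T. f y < c)))"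

text \<open>Subharmonic on an open set U of C (values in [-infinity,infinity)):
  upper semicontinuous and satisfying the harmonic-majorant property on closed discs
  (harmonic functions on a disc are the real parts of holomorphic functions).\<close>
definition subharmonic_on :: "complex set \<Rightarrow> (complex \<Rightarrow> ereal) \<Rightarrow> bool" where
  "subharmonic_on U f \<longleftrightarrow>
     (\<forall>z\<in>U. f z < \<infinity>) \<and> usc_on U f \<and>
     (\<forall>a r h. 0 < r \<longrightarrow> cball a r \<subseteq> U \<longrightarrow> continuous_on (cball a r) h \<longrightarrow>
        h holomorphic_on ball a r \<longrightarrow> (\<forall>z\<in>sphere a r. f z \<le> ereal (Re (h z))) \<longrightarrow>
        (\<forall>z\<in>cball a r. f z \<le> ereal (Re (h z))))"

definition cline :: "(nat \<Rightarrow> complex) \<Rightarrow> (nat \<Rightarrow> complex) \<Rightarrow> complex \<Rightarrow> (nat \<Rightarrow> complex)" where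
  "cline a b l = (\<lambda>i. a i + l * b i)"

definition line_subharmonic :: "nat \<Rightarrow> (nat \<Rightarrow> complex) set \<Rightarrow> ((nat \<Rightarrow> complex) \<Rightarrow> ereal) \<Rightarrow> bool" where
  "line_subharmonic N \<Omega> u \<longleftrightarrow>
     (\<forall>a\<in>cspace N. \<forall>b\<in>cspace N. b \<noteq> (\<lambda>_. 0) \<longrightarrow>
        subharmonic_on {l. cline a b l \<in> \<Omega>} (\<lambda>l. u (cline a b l)))"

definition psh_on :: "nat \<Rightarrow> (nat \<Rightarrow> complex) set \<Rightarrow> ((nat \<Rightarrow> complex) \<Rightarrow> ereal) \<Rightarrow> bool" where
  "psh_on N \<Omega> u \<longleftrightarrow> (\<forall>z\<in>\<Omega>. u z < \<infinity>) \<and> usc_on \<Omega> u \<and> line_subharmonic N \<Omega> u"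

definition loc_unif_bdd_above :: "('a::topological_space \<Rightarrow> ereal) set \<Rightarrow> 'a set \<Rightarrow> bool" where
  "loc_unif_bdd_above \<U> S \<longleftrightarrow>
     (\<forall>C. compact C \<and> C \<subseteq> S \<longrightarrow> (\<exists>c::real. \<forall>u\<in>\<U>. \<forall>x\<in>C. u x \<le> ereal c))"

definition cjoin :: "nat \<Rightarrow> (nat \<Rightarrow> complex) \<Rightarrow> (nat \<Rightarrow> complex) \<Rightarrow> (nat \<Rightarrow> complex)" where
  "cjoin N z w = (\<lambda>i. if i < N then z i else w (i - N))"

definition statement_P :: bool where
  "statement_P \<longleftrightarrow>
     (\<forall>N M D G \<U>. 1 \<le> N \<longrightarrow> 1 \<le> M \<longrightarrow> cdomain N D \<longrightarrow> cdomain M G \<longrightarrow>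
        (\<forall>v\<in>\<U>. psh_on (N + M) ((\<lambda>(z, w). cjoin N z w) ` (D \<times> G)) v) \<longrightarrow>
        (\<forall>w\<in>G. loc_unif_bdd_above \<U> ((\<lambda>z. cjoin N z w) ` D)) \<longrightarrow>
        (\<forall>z\<in>D. loc_unif_bdd_above \<U> ((\<lambda>w. cjoin N z w) ` G)) \<longrightarrow>
        loc_unif_bdd_above \<U> ((\<lambda>(z, w). cjoin N z w) ` (D \<times> G)))"

end

(* Let s* be the upper semicontinuous regularization of s. By (P), applied one coordinate at a
   time on a polydisc, the minorants of u are locally uniformly bounded above, so s* is
   plurisubharmonic; it remains to see that s* <= u, for then s* is itself a minorant and s = s*.
   Suppose minorants v_j satisfy v_j(y_j) > c with y_j -> z, and let K be a local upper bound.
   Harnack's inequality in each coordinate bounds the mean of K - v_j over a torus of polyradius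
   rho about z by (1 + o(1)) (K - v_j(y_j)); hence the mean of the measurable function
   inf_j (K - v_j) over that torus is at most K - c. Every complex line through z meets u in an
   upper semicontinuous function, so by Fatou's lemma as rho -> 0 we get K - u(z) <= K - c. *)
theory Submission
  imports Defs "HOL-Complex_Analysis.Conformal_Mappings"
begin

subsection \<open>Harnack's inequality for subharmonic functions on a disc\<close>

text \<open>The sequence of minorants keeps the infimum countable, hence measurable, and for fixed
  \<open>b\<close> on the unit torus the points z + \<rho> * b all lie on one line, so that
  shrinking \<rho> calls for semicontinuity along that line alone. A plain mean value inequality
  would not suffice, because the minorants are known to be large at \<open>y j\<close> and not at
  \<open>z\<close>. Harnack's inequality handles the displaced point at the price ((1 + t) / (1 -
  t)) ^ N, where t is the displacement divided by \<rho>; with \<rho> fixed this tends to 1. Since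
  subharmonicity is defined by harmonic majorants, the majorants have to be produced: they come from
  polynomials whose real parts approximate continuous data on the circle, and semicontinuous data
  are reached from below. Integrals are taken in \<open>ennreal\<close>, where the value
  -\<infinity> of a minorant does no harm.\<close>

lemma Re_poly_mult_cnj_poly:
  "\<exists>r. \<forall>x\<in>sphere 0 1. Re (poly p x * cnj (poly q x)) = Re (poly r x)"
proof (induction p arbitrary: q)
  case 0
  show ?case by (intro exI[of _ 0]) auto
next
  case (pCons a p)
  obtain b q' where q: "q = pCons b q'" by (cases q)
  obtain r where r: "\<forall>x\<in>sphere 0 1. Re (poly p x * cnj (poly q' x)) = Re (poly r x)"
    using pCons.IH by blast
  \<comment> \<open>On the circle x * cnj x = 1, so the product of the two tails loses its outer
    factors and falls under the induction hypothesis. The other terms are real parts of polynomials,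
    after conjugating a * cnj (poly q x).\<close>
  have "Re (poly (pCons a p) x * cnj (poly q x)) = Re (poly (smult (cnj a) q + smult (cnj b) (pCons 0 p) + r) x)"
    if x: "x \<in> sphere 0 1" for x
  proof -
    have xx: "x * cnj x = 1" using x by (simp add: complex_norm_square[symmetric])
    have "poly (pCons a p) x * cnj (poly q x) =
        a * cnj (poly q x) + x * poly p x * cnj b + (x * cnj x) * (poly p x * cnj (poly q' x))"
      by (simp add: q algebra_simps)
    moreover have "Re (a * cnj (poly q x)) = Re (cnj a * poly q x)" by simp
    ultimately show ?thesis using r x by (simp add: xx algebra_simps)
  qed
  then show ?case by blast
qed

text \<open>Real parts of polynomials extend harmonically to the disc, so this approximation takes
  the place of the Poisson integral. They form an algebra on the circle because Re a * Re b = (Re (a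
  * b) + Re (a * cnj b)) / 2, whose last term the preceding lemma rewrites.\<close>

lemma circle_trig_poly_approx:
  fixes \<psi> :: "complex \<Rightarrow> real"
  assumes "continuous_on (sphere 0 1) \<psi>" "e > 0"
  shows "\<exists>p. \<forall>x\<in>sphere 0 1. \<bar>\<psi> x - Re (poly p x)\<bar> < e"
proof -
  define R :: "(complex \<Rightarrow> real) set" where "R = {g. \<exists>p. \<forall>x\<in>sphere 0 1. g x = Re (poly p x)}"
  have "function_ring_on R (sphere 0 1)"
  proof
    fix f assume "f \<in> R"
    then obtain p where p: "\<forall>x\<in>sphere 0 1. f x = Re (poly p x)" by (auto simp: R_def)
    have "continuous_on (sphere 0 1) (\<lambda>x. Re (poly p x))" by (intro continuous_intros)
    then show "continuous_on (sphere 0 1) f" using p by (metis (mono_tags, lifting) continuous_on_cong)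
  next
    fix f g assume "f \<in> R" "g \<in> R"
    then obtain p q where pq: "\<forall>x\<in>sphere 0 1. f x = Re (poly p x)" "\<forall>x\<in>sphere 0 1. g x = Re (poly q x)"
      by (auto simp: R_def)
    have "\<forall>x\<in>sphere 0 1. f x + g x = Re (poly (p + q) x)" using pq by simp
    then show "(\<lambda>x. f x + g x) \<in> R" unfolding R_def by blast
    obtain r where r: "\<forall>x\<in>sphere 0 1. Re (poly p x * cnj (poly q x)) = Re (poly r x)"
      using Re_poly_mult_cnj_poly by blast
    have "f x * g x = Re (poly (smult (1/2) (p * q + r)) x)" if "x \<in> sphere 0 1" for x
    proof -
      have "Re a * Re b = (Re (a * b) + Re (a * cnj b)) / 2" for a b by simp
      then show ?thesis using pq r that by (simp add: field_simps)
    qed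
    then show "(\<lambda>x. f x * g x) \<in> R" unfolding R_def by blast
  next
    fix c :: real
    have "\<forall>x\<in>sphere 0 1. c = Re (poly [:of_real c:] x)" by simp
    then show "(\<lambda>_. c) \<in> R" unfolding R_def by blast
  next
    fix x y :: complex assume "x \<noteq> y"
    have "\<forall>x\<in>sphere 0 1. Re x = Re (poly [:0, 1:] x)" "\<forall>x\<in>sphere 0 1. Im x = Re (poly [:0, -\<i>:] x)" by auto
    then have "Re \<in> R" "Im \<in> R" unfolding R_def by blast+
    then show "\<exists>f\<in>R. f x \<noteq> f y" using \<open>x \<noteq> y\<close> by (auto simp: complex_eq_iff)
  qed simp
  from function_ring_on.Stone_Weierstrass_basic[OF this assms] show ?thesis
    unfolding R_def by (force)
qed

section \<open>Holomorphic functions with positive real part\<close>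

lemma Harnack_unit_disc_0:
  assumes hol: "h holomorphic_on ball 0 1"
    and pos: "\<And>x. norm x < 1 \<Longrightarrow> 0 < Re (h x)"
    and w: "norm w \<le> t" "t < 1"
  shows "(1 - t) / (1 + t) * Re (h 0) \<le> Re (h w)"
proof -
  \<comment> \<open>Removing the imaginary part at 0 makes \<open>k 0\<close> real, so the Cayley
    transform \<open>q\<close> below maps the disc into itself and fixes 0. Schwarz's lemma bounds
    norm (q w) by t; solving for \<open>k w\<close> gives a real part that is smallest when q w =
    -s.\<close>
  define k where "k x = h x - \<i> * of_real (Im (h 0))" for x
  define \<alpha> where "\<alpha> = Re (h 0)"
  have k0: "k 0 = of_real \<alpha>" by (simp add: k_def \<alpha>_def complex_eq_iff)
  have Rek: "Re (k x) = Re (h x)" for x by (simp add: k_def)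
  have \<alpha>: "\<alpha> > 0" using pos[of 0] by (simp add: \<alpha>_def)
  have nz: "k x + of_real \<alpha> \<noteq> 0" if "norm x < 1" for x
    using pos[OF that] \<alpha> Rek[of x] by (auto simp: complex_eq_iff)
  define q where "q x = (k x - of_real \<alpha>) / (k x + of_real \<alpha>)" for x
  have "k holomorphic_on ball 0 1" unfolding k_def by (intro holomorphic_intros hol)
  then have q_hol: "q holomorphic_on ball 0 1"
    unfolding q_def using nz by (intro holomorphic_intros) auto
  have q_lt: "norm (q x) < 1" if "norm x < 1" for x
  proof -
    have "(norm (k x - of_real \<alpha>))\<^sup>2 < (norm (k x + of_real \<alpha>))\<^sup>2"
      unfolding cmod_power2 using pos[OF that] Rek[of x] \<alpha> by (simp add: power2_eq_square algebra_simps)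
    then have "norm (k x - of_real \<alpha>) < norm (k x + of_real \<alpha>)"
      by (meson norm_ge_zero power_less_imp_less_base)
    then show ?thesis using nz[OF that] by (simp add: q_def norm_divide divide_simps)
  qed
  have w1: "norm w < 1" using w by simp
  have qw: "norm (q w) \<le> t"
    using Schwarz_Lemma(1)[OF q_hol _ q_lt w1] w(1) k0 by (simp add: q_def)
  define s where "s = norm (q w)"
  have s: "0 \<le> s" "s \<le> t" "s < 1" using qw w by (auto simp: s_def)
  have q1: "1 - q w \<noteq> 0" using s by (auto simp: s_def)
  have kw: "k w * (1 - q w) = of_real \<alpha> * (1 + q w)"
    using nz[OF w1] unfolding q_def by (simp add: field_simps)
  have "k w = of_real \<alpha> * (1 + q w) / (1 - q w)" using kw q1 by (simp add: field_simps)
  also have "\<dots> = of_real \<alpha> * ((1 + q w) * cnj (1 - q w)) / of_real ((norm (1 - q w))\<^sup>2)"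
    using q1 unfolding complex_norm_square by simp
  finally have "Re (k w) = Re (of_real \<alpha> * ((1 + q w) * cnj (1 - q w))) / (norm (1 - q w))\<^sup>2"
    by (simp only: Re_divide_of_real)
  moreover have "s\<^sup>2 = (Re (q w))\<^sup>2 + (Im (q w))\<^sup>2" unfolding s_def by (rule cmod_power2)
  then have "Re (of_real \<alpha> * ((1 + q w) * cnj (1 - q w))) = \<alpha> * (1 - s\<^sup>2)"
    by (simp add: power2_eq_square algebra_simps)
  ultimately have "Re (k w) = \<alpha> * (1 - s\<^sup>2) / (norm (1 - q w))\<^sup>2" by simp
  moreover have "\<alpha> * (1 - s\<^sup>2) / (1 + s)\<^sup>2 \<le> \<alpha> * (1 - s\<^sup>2) / (norm (1 - q w))\<^sup>2"
  proof (rule divide_left_mono)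
    have "norm (1 - q w) \<le> 1 + s" using norm_triangle_ineq4[of 1 "q w"] by (simp add: s_def)
    then show "(norm (1 - q w))\<^sup>2 \<le> (1 + s)\<^sup>2" by (simp add: power_mono)
    show "0 \<le> \<alpha> * (1 - s\<^sup>2)" using \<alpha> s by (simp add: power_le_one)
    show "0 < (1 + s)\<^sup>2 * (norm (1 - q w))\<^sup>2" using q1 s by simp
  qed
  moreover have "\<alpha> * (1 - s\<^sup>2) / (1 + s)\<^sup>2 = (1 - s) / (1 + s) * \<alpha>"
    using s by (simp add: divide_simps power2_eq_square) (simp add: algebra_simps)
  moreover have "(1 - t) / (1 + t) * \<alpha> \<le> (1 - s) / (1 + s) * \<alpha>"
    using s w \<alpha> by (intro mult_right_mono frac_le) auto
  ultimately show ?thesis by (simp add: Rek \<alpha>_def)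
qed

text \<open>The maximum principle for -h carries the sign from the circle into the disc. Adding e >
  0 gives the strict positivity that the Cayley transform requires.\<close>

lemma Harnack_unit_disc:
  assumes hol: "h holomorphic_on UNIV"
    and pos: "\<And>x. norm x = 1 \<Longrightarrow> 0 \<le> Re (h x)"
    and w: "norm w \<le> t" "t < 1"
  shows "(1 - t) / (1 + t) * Re (h 0) \<le> Re (h w)"
proof (rule field_le_epsilon)
  fix e :: real assume e: "e > 0"
  have cont: "continuous_on S h" for S
    using holomorphic_on_imp_continuous_on[OF hol] continuous_on_subset by blast
  have nonneg: "0 \<le> Re (h x)" if "norm x < 1" for x
  proof -
    have "Re (- h x) \<le> 0"
    proof (rule maximum_real_frontier[where S = "ball 0 1" and f = "\<lambda>x. - h x"])
      show "(\<lambda>x. - h x) holomorphic_on interior (ball 0 1)"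
        by (intro holomorphic_intros holomorphic_on_subset[OF hol]) auto
      show "continuous_on (closure (ball 0 1)) (\<lambda>x. - h x)" by (intro continuous_intros cont)
      show "\<And>z. z \<in> frontier (ball 0 1) \<Longrightarrow> Re (- h z) \<le> 0" using pos by (auto simp: frontier_def)
    qed (use that in auto)
    then show ?thesis by simp
  qed
  have t: "0 \<le> t" using w(1) norm_ge_zero order_trans by blast
  have "(1 - t) / (1 + t) * Re (h 0 + of_real e) \<le> Re (h w + of_real e)"
  proof (rule Harnack_unit_disc_0[where h = "\<lambda>x. h x + of_real e"])
    show "(\<lambda>x. h x + complex_of_real e) holomorphic_on ball 0 1"
      by (intro holomorphic_intros holomorphic_on_subset[OF hol]) auto
    show "\<And>x. cmod x < 1 \<Longrightarrow> 0 < Re (h x + complex_of_real e)"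
      using nonneg e by (simp add: add_nonneg_pos)
  qed (use w in auto)
  moreover have "0 \<le> (1 - t) / (1 + t) * e" using t w e by simp
  ultimately show "(1 - t) / (1 + t) * Re (h 0) \<le> Re (h w) + e" by (simp add: distrib_left)
qed

text \<open>Cauchy's formula at the centre: on the unit circle the derivative of the path divided by
  its value is the constant 2 * pi * \<i>.\<close>

lemma has_integral_circle_mean:
  assumes hol: "h holomorphic_on UNIV"
  shows "((\<lambda>t. Re (h (cis (2 * pi * t)))) has_integral Re (h 0)) {0..1}"
proof -
  have "((\<lambda>u. h u / (u - 0)) has_contour_integral (2 * of_real pi * \<i> * h 0)) (circlepath 0 1)"
    by (rule Cauchy_integral_circlepath_simple) (auto intro: holomorphic_on_subset[OF hol])
  then have "((\<lambda>t. 2 * of_real pi * \<i> * h (cis (2 * pi * t))) has_integral (2 * of_real pi * \<i> * h 0)) {0..1}"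
    unfolding has_contour_integral_def
  proof (rule has_integral_eq[rotated])
    fix x :: real assume "x \<in> {0..1}"
    moreover have "circlepath 0 1 x = cis (2 * pi * x)"
      by (simp add: circlepath cis_conv_exp mult_ac)
    ultimately show "h (circlepath 0 1 x) / (circlepath 0 1 x - 0) * vector_derivative (circlepath 0 1) (at x within {0..1})
        = 2 * of_real pi * \<i> * h (cis (2 * pi * x))"
      by (simp add: vector_derivative_circlepath01 cis_conv_exp mult_ac)
  qed
  then have "((\<lambda>t. (1 / (2 * of_real pi * \<i>)) * (2 * of_real pi * \<i> * h (cis (2 * pi * t)))) has_integral
      (1 / (2 * of_real pi * \<i>)) * (2 * of_real pi * \<i> * h 0)) {0..1}"
    by (rule has_integral_mult_right)
  then have "((\<lambda>t. h (cis (2 * pi * t))) has_integral h 0) {0..1}" by simp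
  from has_integral_linear[OF this bounded_linear_Re] show ?thesis by (simp add: o_def)
qed


section \<open>From continuous to semicontinuous functions on the circle\<close>

lemma lsc_approx_continuous:
  fixes f :: "'a::metric_space \<Rightarrow> ennreal"
  assumes lsc: "\<And>x c. x \<in> S \<Longrightarrow> c < f x \<Longrightarrow> \<exists>T. open T \<and> x \<in> T \<and> (\<forall>y\<in>S \<inter> T. c < f y)"
  obtains \<psi> :: "nat \<Rightarrow> 'a \<Rightarrow> real"
  where "\<And>n. continuous_on UNIV (\<psi> n)" "\<And>n x. x \<in> S \<Longrightarrow> 0 \<le> \<psi> n x"
    "\<And>n x. x \<in> S \<Longrightarrow> ennreal (\<psi> n x) \<le> f x"
    "\<And>x. x \<in> S \<Longrightarrow> f x \<le> liminf (\<lambda>n. ennreal (\<psi> n x))"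
proof (cases "S = {}")
  case True
  then show ?thesis by (intro that[of "\<lambda>_ _. 0"]) auto
next
  case False
  define F where "F n y = enn2real (min (f y) (of_nat n))" for n y
  \<comment> \<open>Infimal convolution with n * dist is n-Lipschitz however irregular
    \<open>f\<close> is. Truncating \<open>f\<close> at n keeps everything real where
    \<open>f\<close> is infinite.\<close>
  define \<psi> where "\<psi> n x = (INF y\<in>S. F n y + real n * dist x y)" for n x
  have F0: "0 \<le> F n y" for n y by (simp add: F_def)
  have fin: "min (f y) (of_nat n) < top" for n y
    by (auto simp: min_less_iff_disj ennreal_of_nat_eq_real_of_nat)
  have Ff: "ennreal (F n y) = min (f y) (of_nat n)" for n y
    unfolding F_def using fin by (intro ennreal_enn2real)
  have bdd: "bdd_below ((\<lambda>y. F n y + real n * dist x y) ` S)" for n x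
    by (rule bdd_belowI[of _ 0]) (auto simp: F0)
  have up: "\<psi> n x \<le> F n y + real n * dist x y" if "y \<in> S" for n x y
    unfolding \<psi>_def by (intro cINF_lower bdd that)
  have lo: "c \<le> \<psi> n x" if "\<And>y. y \<in> S \<Longrightarrow> c \<le> F n y + real n * dist x y" for c n x
    unfolding \<psi>_def using False that by (intro cINF_greatest) auto
  show ?thesis
  proof (rule that[of \<psi>])
    fix n
    have le: "\<psi> n x \<le> \<psi> n x' + real n * dist x x'" for x x'
    proof -
      have "\<psi> n x - real n * dist x x' \<le> \<psi> n x'"
      proof (rule lo)
        fix y assume "y \<in> S"
        have "real n * dist x y \<le> real n * (dist x x' + dist x' y)"
          by (intro mult_left_mono dist_triangle) auto
        then show "\<psi> n x - real n * dist x x' \<le> F n y + real n * dist x' y"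
          using up[OF \<open>y \<in> S\<close>, of n x] by (simp add: distrib_left)
      qed
      then show ?thesis by simp
    qed
    have "(real n)-lipschitz_on UNIV (\<psi> n)"
    proof (rule lipschitz_onI)
      fix x x' show "dist (\<psi> n x) (\<psi> n x') \<le> real n * dist x x'"
        using le[of x x'] le[of x' x] by (simp add: dist_real_def dist_commute abs_le_iff)
    qed simp
    then show "continuous_on UNIV (\<psi> n)" by (rule lipschitz_on_continuous_on)
  next
    fix n x assume x: "x \<in> S"
    show "0 \<le> \<psi> n x" by (rule lo) (simp add: F0)
    have "ennreal (\<psi> n x) \<le> ennreal (F n x)" using up[OF x, of n x] by (intro ennreal_leI) simp
    also have "\<dots> \<le> f x" by (simp add: Ff)
    finally show "ennreal (\<psi> n x) \<le> f x" .
  next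
    fix x assume x: "x \<in> S"
    show "f x \<le> liminf (\<lambda>n. ennreal (\<psi> n x))"
      unfolding le_Liminf_iff
    proof (intro allI impI)
      fix c assume "c < f x"
      then obtain c' where c': "c < c'" "c' < f x" using dense by blast
      then have "c' < top" using order_less_le_trans top_greatest by blast
      then obtain r where r: "c' = ennreal r" "0 \<le> r" by (cases c') auto
      obtain T where T: "open T" "x \<in> T" "\<And>y. y \<in> S \<Longrightarrow> y \<in> T \<Longrightarrow> c' < f y"
        using lsc[OF x c'(2)] by blast
      obtain \<delta> where \<delta>: "\<delta> > 0" "ball x \<delta> \<subseteq> T" using T openE by blast
      \<comment> \<open>The first bound keeps the truncation at n \<ge> m from cutting below the
        level r. The second makes the penalty n * dist at least r outside the ball of radius
        \<delta>; inside it, lower semicontinuity supplies the level.\<close>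
      obtain m where m: "r \<le> real m" "r / \<delta> \<le> real m"
        using real_arch_simple[of "max r (r / \<delta>)"] by auto
      have "c < ennreal (\<psi> n x)" if n: "n \<ge> m" for n
      proof -
        have "r \<le> \<psi> n x"
        proof (rule lo)
          fix y assume y: "y \<in> S"
          show "r \<le> F n y + real n * dist x y"
          proof (cases "dist x y < \<delta>")
            case True
            then have "c' < f y" using T(3) y \<delta> by auto
            moreover have "c' \<le> of_nat n"
              using m n r by (simp add: ennreal_of_nat_eq_real_of_nat ennreal_leI)
            ultimately have "ennreal r \<le> ennreal (F n y)" unfolding Ff using r by auto
            then have "r \<le> F n y" using F0 by (simp add: ennreal_le_iff)
            then show ?thesis by (simp add: add_increasing2)
          next
            case False
            have "r \<le> real m * \<delta>" using m \<delta> by (simp add: field_simps)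
            also have "\<dots> \<le> real n * dist x y" using n False \<delta> by (intro mult_mono) auto
            finally show ?thesis using F0[of n y] by simp
          qed
        qed
        then have "c' \<le> ennreal (\<psi> n x)" unfolding r by (rule ennreal_leI)
        then show ?thesis using c'(1) by simp
      qed
      then show "\<forall>\<^sub>F n in sequentially. c < ennreal (\<psi> n x)"
        unfolding eventually_sequentially by blast
    qed
  qed
qed

abbreviation unit_interval :: "real measure" where
  "unit_interval \<equiv> restrict_space lborel {0..1}"

text \<open>If Re p lies slightly above \<psi> on the circle, then K + 2 * e - Re p is harmonic and
  majorizes \<phi> there, hence also at w. This bounds Re p at the point corresponding to w, and
  Harnack's inequality carries the bound to the centre, where Re p equals its circle mean.\<close>

lemma circle_integral_continuous_minorant_le:
  assumes sub: "subharmonic_on U \<phi>" and cb: "cball a \<rho> \<subseteq> U" and \<rho>: "0 < \<rho>"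
    and wt: "dist w a \<le> t * \<rho>" "t < 1"
    and cont: "continuous_on UNIV \<psi>" and nonneg: "\<And>x. norm x = 1 \<Longrightarrow> 0 \<le> \<psi> x"
    and le: "\<And>x. norm x = 1 \<Longrightarrow> \<phi> (a + of_real \<rho> * x) \<le> ereal (K - \<psi> x)"
    and r: "ereal r \<le> \<phi> w"
  shows "integral {0..1} (\<lambda>s. \<psi> (cis (2 * pi * s))) \<le> (1 + t) / (1 - t) * (K - r)"
proof (rule field_le_epsilon)
  fix e' :: real assume e': "e' > 0"
  have "0 \<le> t * \<rho>" using wt(1) zero_le_dist order_trans by blast
  then have t: "0 \<le> t" using \<rho> by (simp add: zero_le_mult_iff)
  define C where "C = (1 + t) / (1 - t)"
  have C: "C > 0" using t wt by (simp add: C_def)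
  \<comment> \<open>The loss 2 * e in the majorant is multiplied by C and so becomes e'.\<close>
  define e where "e = e' / (2 * C)"
  have e: "e > 0" using C e' by (simp add: e_def)
  \<comment> \<open>Approximating \<psi> + e within e places the approximant between \<psi> and
    \<psi> + 2 * e. The lower bound makes it nonnegative, as Harnack's inequality demands.\<close>
  have "continuous_on (sphere 0 1) (\<lambda>x. \<psi> x + e)"
    by (intro continuous_intros continuous_on_subset[OF cont]) auto
  from circle_trig_poly_approx[OF this e] obtain p
    where "\<forall>x\<in>sphere 0 1. \<bar>\<psi> x + e - Re (poly p x)\<bar> < e" by blast
  then have p: "\<psi> x \<le> Re (poly p x)" "Re (poly p x) \<le> \<psi> x + 2 * e" if "norm x = 1" for x
    using that by (auto simp: abs_less_iff dest!: bspec[of _ _ x])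
  define w' where "w' = (w - a) / of_real \<rho>"
  have w': "norm w' \<le> t" using wt \<rho> by (simp add: w'_def norm_divide dist_norm field_simps)
  define h where "h x = of_real (K + 2 * e) - poly p ((x - a) / of_real \<rho>)" for x
  have hol: "h holomorphic_on S" for S unfolding h_def by (intro holomorphic_intros) (use \<rho> in auto)
  have "\<phi> w \<le> ereal (Re (h w))"
  proof -
    have "\<forall>z\<in>sphere a \<rho>. \<phi> z \<le> ereal (Re (h z))"
    proof
      fix z assume z: "z \<in> sphere a \<rho>"
      define x where "x = (z - a) / of_real \<rho>"
      have x: "norm x = 1" "z = a + of_real \<rho> * x"
        using z \<rho> by (auto simp: x_def norm_divide dist_norm norm_minus_commute)
      have "\<phi> z \<le> ereal (K - \<psi> x)" using le x by simp
      also have "\<dots> \<le> ereal (Re (h z))" using p(2)[OF x(1)] by (simp add: h_def x_def)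
      finally show "\<phi> z \<le> ereal (Re (h z))" .
    qed
    moreover have "w \<in> cball a \<rho>"
    proof -
      have "t * \<rho> \<le> 1 * \<rho>" using wt(2) \<rho> by (intro mult_right_mono) auto
      then show ?thesis using wt(1) by (simp add: dist_commute)
    qed
    moreover have "continuous_on (cball a \<rho>) h" "h holomorphic_on ball a \<rho>"
      using hol holomorphic_on_imp_continuous_on by blast+
    ultimately show ?thesis using sub cb \<rho> unfolding subharmonic_on_def by blast
  qed
  then have "ereal r \<le> ereal (Re (h w))" using r order_trans by blast
  then have pw: "Re (poly p w') \<le> K + 2 * e - r" by (simp add: h_def w'_def)
  have polyhol: "poly p holomorphic_on UNIV" by (intro holomorphic_intros)
  have "integral {0..1} (\<lambda>s. \<psi> (cis (2 * pi * s))) \<le> Re (poly p 0)"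
  proof (rule has_integral_le[OF integrable_integral has_integral_circle_mean[OF polyhol]])
    show "(\<lambda>s. \<psi> (cis (2 * pi * s))) integrable_on {0..1}"
      by (intro integrable_continuous_real continuous_on_compose2[OF cont] continuous_intros) auto
  qed (use p in auto)
  also have "\<dots> \<le> C * Re (poly p w')"
  proof -
    have "(1 - t) / (1 + t) * Re (poly p 0) \<le> Re (poly p w')"
      by (rule Harnack_unit_disc[OF polyhol _ w' wt(2)]) (use p nonneg order_trans in blast)
    then show ?thesis using t wt by (simp add: C_def field_simps)
  qed
  also have "\<dots> \<le> C * (K + 2 * e - r)" using pw C by simp
  also have "\<dots> = C * (K - r) + e'" using C by (simp add: e_def field_simps)
  finally show "integral {0..1} (\<lambda>s. \<psi> (cis (2 * pi * s))) \<le> (1 + t) / (1 - t) * (K - r) + e'"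
    by (simp add: C_def)
qed

text \<open>\<open>e2ennreal\<close> clips negative values to 0; the bound x \<le> K rules this out,
  which matters when r = 0.\<close>

lemma ennreal_le_e2ennreal_iff:
  assumes "0 \<le> r" "x \<le> ereal K"
  shows "ennreal r \<le> e2ennreal (ereal K - x) \<longleftrightarrow> x \<le> ereal (K - r)"
proof (cases x)
  case (real y)
  then show ?thesis using assms by (auto simp: e2ennreal_ereal ennreal_le_iff2)
next
  case MInf
  then show ?thesis by (simp add: e2ennreal_infty)
next
  case PInf
  then show ?thesis using assms by (auto simp: e2ennreal_neg ennreal_eq_0_iff)
qed


lemma usc_imp_lsc_e2ennreal:
  assumes usc: "usc_on U \<phi>" and x: "x \<in> U" and c: "c < e2ennreal (ereal K - \<phi> x)"
  shows "\<exists>T. open T \<and> x \<in> T \<and> (\<forall>y\<in>U \<inter> T. c < e2ennreal (ereal K - \<phi> y))"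
proof -
  obtain c' where c': "c < c'" "c' < e2ennreal (ereal K - \<phi> x)" using dense[OF c] by blast
  then have "c' < top" using order_less_le_trans top_greatest by blast
  then obtain r where r: "c' = ennreal r" "0 \<le> r" by (cases c') auto
  have *: "ennreal r < e2ennreal (ereal K - y) \<longleftrightarrow> y < ereal (K - r)" for y
  proof (cases y)
    case (real q)
    then show ?thesis using r by (auto simp: e2ennreal_ereal ennreal_less_iff)
  next
    case MInf
    then show ?thesis by (simp add: e2ennreal_infty)
  next
    case PInf
    then show ?thesis by (auto simp: e2ennreal_neg)
  qed
  obtain T where "open T" "x \<in> T" "\<forall>y\<in>U \<inter> T. \<phi> y < ereal (K - r)"
    using usc x c'(2) unfolding r * usc_on_def by blast
  then show ?thesis using c'(1) unfolding r by (meson * order_less_trans)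
qed

text \<open>The estimate holds for each continuous minorant of K - \<phi> on the circle, and Fatou's
  lemma passes it on. If \<phi> w = -\<infinity>, the right-hand side is infinite because the
  Harnack factor is positive.\<close>

lemma subharmonic_Harnack:
  assumes sub: "subharmonic_on U \<phi>" and cb: "cball a \<rho> \<subseteq> U" and \<rho>: "0 < \<rho>"
    and wt: "dist w a \<le> t * \<rho>" "t < 1"
    and K: "\<And>z. z \<in> cball a \<rho> \<Longrightarrow> \<phi> z \<le> ereal K"
  shows "(\<integral>\<^sup>+s. e2ennreal (ereal K - \<phi> (a + of_real \<rho> * cis (2 * pi * s))) \<partial>unit_interval)
      \<le> ennreal ((1 + t) / (1 - t)) * e2ennreal (ereal K - \<phi> w)"
proof -
  have "0 \<le> t * \<rho>" using wt(1) zero_le_dist order_trans by blast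
  then have t: "0 \<le> t" using \<rho> by (simp add: zero_le_mult_iff)
  define C where "C = (1 + t) / (1 - t)"
  have C: "C > 0" using t wt by (simp add: C_def)
  have wK: "\<phi> w \<le> ereal K"
  proof (rule K)
    have "t * \<rho> \<le> 1 * \<rho>" using wt(2) \<rho> by (intro mult_right_mono) auto
    then show "w \<in> cball a \<rho>" using wt(1) by (simp add: dist_commute)
  qed
  define f where "f x = e2ennreal (ereal K - \<phi> (a + of_real \<rho> * x))" for x
  have on_circle: "a + of_real \<rho> * x \<in> cball a \<rho>" if "norm x = 1" for x
    using that \<rho> by (simp add: dist_norm norm_mult)
  have usc: "usc_on U \<phi>" using sub by (simp add: subharmonic_on_def)
  have lsc: "\<exists>T. open T \<and> x \<in> T \<and> (\<forall>y\<in>sphere 0 1 \<inter> T. c < f y)"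
    if x: "x \<in> sphere 0 1" and c: "c < f x" for x c
  proof -
    have "a + of_real \<rho> * x \<in> U" using on_circle x cb by auto
    from usc_imp_lsc_e2ennreal[OF usc this c[unfolded f_def]]
    obtain T where T: "open T" "a + of_real \<rho> * x \<in> T"
      "\<And>y. y \<in> U \<inter> T \<Longrightarrow> c < e2ennreal (ereal K - \<phi> y)" by blast
    have "continuous_on UNIV (\<lambda>y. a + of_real \<rho> * y)" by (intro continuous_intros)
    then have "open ((\<lambda>y. a + of_real \<rho> * y) -` T)"
      using T(1) by (simp add: open_vimage)
    moreover have "c < f y" if "y \<in> sphere 0 1 \<inter> (\<lambda>y. a + of_real \<rho> * y) -` T" for y
      unfolding f_def using that T(3) on_circle[of y] cb by auto
    ultimately show ?thesis using T(2) by (intro exI[of _ "(\<lambda>y. a + of_real \<rho> * y) -` T"]) auto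
  qed
  obtain \<psi> :: "nat \<Rightarrow> complex \<Rightarrow> real" where \<psi>: "\<And>n. continuous_on UNIV (\<psi> n)"
    "\<And>n x. x \<in> sphere 0 1 \<Longrightarrow> 0 \<le> \<psi> n x"
    "\<And>n x. x \<in> sphere 0 1 \<Longrightarrow> ennreal (\<psi> n x) \<le> f x"
    "\<And>x. x \<in> sphere 0 1 \<Longrightarrow> f x \<le> liminf (\<lambda>n. ennreal (\<psi> n x))"
    using lsc_approx_continuous[of "sphere 0 1" f] lsc by blast
  have bound: "(\<integral>\<^sup>+s. ennreal (\<psi> n (cis (2 * pi * s))) \<partial>unit_interval) \<le> ennreal C * e2ennreal (ereal K - \<phi> w)" for n
  proof -
    define I where "I = integral {0..1} (\<lambda>s. \<psi> n (cis (2 * pi * s)))"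
    have "(\<lambda>s. \<psi> n (cis (2 * pi * s))) integrable_on {0..1}"
      by (intro integrable_continuous_real continuous_on_compose2[OF \<psi>(1)] continuous_intros) auto
    then have hasI: "((\<lambda>s. \<psi> n (cis (2 * pi * s))) has_integral I) {0..1}"
      unfolding I_def by (rule integrable_integral)
    have "(\<integral>\<^sup>+s. ennreal (\<psi> n (cis (2 * pi * s))) \<partial>unit_interval)
        = (\<integral>\<^sup>+s. ennreal (\<psi> n (cis (2 * pi * s))) * indicator {0..1} s \<partial>lborel)"
      by (rule nn_integral_restrict_space) auto
    also have "\<dots> = ennreal I"
      by (rule nn_integral_has_integral_lebesgue'[OF _ hasI]) (use \<psi>(2) in auto)
    finally have *: "(\<integral>\<^sup>+s. ennreal (\<psi> n (cis (2 * pi * s))) \<partial>unit_interval) = ennreal I" .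
    have r: "I \<le> C * (K - r)" if "ereal r \<le> \<phi> w" for r
      unfolding I_def C_def
    proof (rule circle_integral_continuous_minorant_le[OF sub cb \<rho> wt \<psi>(1) _ _ that])
      fix x :: complex assume x: "norm x = 1"
      then show "0 \<le> \<psi> n x" using \<psi>(2) by auto
      then show "\<phi> (a + of_real \<rho> * x) \<le> ereal (K - \<psi> n x)"
        using \<psi>(3)[of x n] x K[OF on_circle[OF x]] by (simp add: f_def ennreal_le_e2ennreal_iff)
    qed
    show ?thesis
    proof (cases "\<phi> w")
      case (real r)
      have "ennreal I \<le> ennreal (C * (K - r))" using r[of r] real by (intro ennreal_leI) simp
      also have "\<dots> = ennreal C * e2ennreal (ereal K - \<phi> w)"
        using real C wK by (simp add: e2ennreal_ereal ennreal_mult)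
      finally show ?thesis unfolding * .
    next
      case MInf
      then show ?thesis using C by (simp add: e2ennreal_infty ennreal_mult_top)
    next
      case PInf
      then show ?thesis using wK by simp
    qed
  qed
  have "(\<integral>\<^sup>+s. f (cis (2 * pi * s)) \<partial>unit_interval)
      \<le> (\<integral>\<^sup>+s. liminf (\<lambda>n. ennreal (\<psi> n (cis (2 * pi * s)))) \<partial>unit_interval)"
    by (intro nn_integral_mono \<psi>(4)) auto
  also have "\<dots> \<le> liminf (\<lambda>n. \<integral>\<^sup>+s. ennreal (\<psi> n (cis (2 * pi * s))) \<partial>unit_interval)"
  proof (rule nn_integral_liminf)
    fix n
    have "continuous_on UNIV (\<lambda>s. \<psi> n (cis (2 * pi * s)))"
      by (intro continuous_on_compose2[OF \<psi>(1)] continuous_intros) auto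
    then have "(\<lambda>s. \<psi> n (cis (2 * pi * s))) \<in> borel_measurable borel"
      by (rule borel_measurable_continuous_onI)
    then show "(\<lambda>s. ennreal (\<psi> n (cis (2 * pi * s)))) \<in> borel_measurable unit_interval"
      by (intro measurable_compose[OF _ measurable_ennreal] measurable_restrict_space1) simp
  qed
  also have "\<dots> \<le> ennreal C * e2ennreal (ereal K - \<phi> w)"
    using bound by (intro Liminf_le) auto
  finally show ?thesis unfolding f_def C_def .
qed

subsection \<open>Polydiscs and local bounds from (P)\<close>

text \<open>Polydiscs serve as balls because they are products: splitting off the last coordinate
  yields the domain D \<times> G that \<open>statement_P\<close> asks for.\<close>

definition polydisc :: "nat \<Rightarrow> (nat \<Rightarrow> complex) \<Rightarrow> real \<Rightarrow> (nat \<Rightarrow> complex) set" where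
  "polydisc N z r = {y \<in> cspace N. \<forall>i<N. dist (y i) (z i) < r}"

lemma polydisc_subset_cspace: "polydisc N z r \<subseteq> cspace N"
  by (auto simp: polydisc_def)

lemma polydisc_mono: "r \<le> r' \<Longrightarrow> polydisc N z r \<subseteq> polydisc N z r'"
  by (auto simp: polydisc_def)

lemma center_in_polydisc: "z \<in> cspace N \<Longrightarrow> 0 < r \<Longrightarrow> z \<in> polydisc N z r"
  by (auto simp: polydisc_def)

lemma polydisc_half_subset:
  assumes "y \<in> polydisc N z (r / 2)"
  shows "polydisc N y (r / 2) \<subseteq> polydisc N z r"
proof
  fix x assume x: "x \<in> polydisc N y (r / 2)"
  have "dist (x i) (z i) < r" if "i < N" for i
    by (rule dist_triangle_half_r[of "y i"]) (use x assms that in \<open>auto simp: polydisc_def dist_commute\<close>)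
  then show "x \<in> polydisc N z r" using x by (auto simp: polydisc_def)
qed

lemma polydisc_eq_open_Int: "\<exists>T. open T \<and> polydisc N z r = cspace N \<inter> T"
proof -
  have "open {f :: nat \<Rightarrow> complex. \<forall>i\<in>{..<N}. f i \<in> ball (z i) r}"
    by (rule product_topology_basis') auto
  moreover have "polydisc N z r = cspace N \<inter> {f. \<forall>i\<in>{..<N}. f i \<in> ball (z i) r}"
    by (auto simp: polydisc_def dist_commute)
  ultimately show ?thesis by blast
qed

lemma copen_eq_Int: "copen N \<Omega> \<Longrightarrow> \<exists>T. open T \<and> \<Omega> = cspace N \<inter> T"
  by (auto simp: copen_def openin_open)

lemma copen_subset_cspace: "copen N \<Omega> \<Longrightarrow> \<Omega> \<subseteq> cspace N"
  by (auto simp: copen_def)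

lemma copen_polydisc: "copen N (polydisc N z r)"
  using polydisc_eq_open_Int[of N z r] polydisc_subset_cspace by (auto simp: copen_def openin_open)

lemma open_contains_polydisc:
  assumes T: "open T" "z \<in> T" and z: "z \<in> cspace N"
  shows "\<exists>r>0. polydisc N z r \<subseteq> T"
proof -
  obtain X where X: "z \<in> (\<Pi>\<^sub>E i\<in>UNIV. X i)" "\<And>i. open (X i)" "(\<Pi>\<^sub>E i\<in>UNIV. X i) \<subseteq> T"
    using product_topology_open_contains_basis[of "\<lambda>i. euclidean" UNIV T z] T
    by (auto simp: open_fun_def)
  have "\<forall>i. \<exists>e>0. ball (z i) e \<subseteq> X i" using X(1,2) open_contains_ball by (metis PiE_mem UNIV_I)
  then obtain e where e: "\<And>i. e i > 0" "\<And>i. ball (z i) (e i) \<subseteq> X i" by metis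
  \<comment> \<open>From N on all points of \<open>cspace N\<close> agree, so finitely many radii
    matter. The inserted 1 covers N = 0.\<close>
  define r where "r = Min (insert 1 (e ` {..<N}))"
  have r: "r > 0" "\<And>i. i < N \<Longrightarrow> r \<le> e i" using e(1) by (auto simp: r_def)
  have "y \<in> T" if y: "y \<in> polydisc N z r" for y
  proof -
    have "y i \<in> X i" for i
    proof (cases "i < N")
      case True
      then have "dist (z i) (y i) < e i" using y r(2)[OF True] by (auto simp: polydisc_def dist_commute)
      then show ?thesis using e(2)[of i] by (auto simp: subset_iff)
    next
      case False
      then have "y i = z i" using y z by (auto simp: polydisc_def cspace_def)
      then show ?thesis using X(1) by auto
    qed
    then show ?thesis using X(3) by auto
  qed
  then show ?thesis using r(1) by blast
qed

lemma copen_contains_polydisc: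
  assumes "copen N \<Omega>" "z \<in> \<Omega>"
  shows "\<exists>r>0. polydisc N z r \<subseteq> \<Omega>"
proof -
  obtain T where "open T" "\<Omega> = cspace N \<inter> T" using copen_eq_Int[OF assms(1)] by blast
  then show ?thesis using open_contains_polydisc[of T z N] assms(2) polydisc_subset_cspace by fast
qed

lemma connected_polydisc: "connected (polydisc N z r)"
proof -
  have "polydisc N z r = (\<Pi>\<^sub>E i\<in>UNIV. if i < N then ball (z i) r else {0})"
    by (auto simp: polydisc_def cspace_def PiE_iff dist_commute split: if_splits)
  moreover have "connectedin (product_topology (\<lambda>i. euclidean) UNIV)
      (\<Pi>\<^sub>E i\<in>(UNIV :: nat set). if i < N then ball (z i) r else {0})"
    unfolding connectedin_PiE by auto
  ultimately show ?thesis by (simp add: euclidean_product_topology)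
qed

lemma compact_closed_polydisc: "compact {y \<in> cspace N. \<forall>i<N. dist (y i) (z i) \<le> r}"
proof -
  have "{y \<in> cspace N. \<forall>i<N. dist (y i) (z i) \<le> r} = (\<Pi>\<^sub>E i\<in>UNIV. if i < N then cball (z i) r else {0})"
    by (auto simp: cspace_def PiE_iff dist_commute split: if_splits)
  moreover have "compactin (product_topology (\<lambda>i. euclidean) UNIV)
      (\<Pi>\<^sub>E i\<in>(UNIV :: nat set). if i < N then cball (z i) r else {0})"
    unfolding compactin_PiE by auto
  ultimately show ?thesis by (simp add: euclidean_product_topology)
qed

section \<open>Restriction and composition of semicontinuous and subharmonic functions\<close>

lemma usc_on_subset:
  assumes "usc_on S f" "S' \<subseteq> S"
  shows "usc_on S' f"
  unfolding usc_on_def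
proof (intro ballI allI impI)
  fix x c assume "x \<in> S'" "f x < c"
  then obtain T where "open T" "x \<in> T" "\<forall>y\<in>S \<inter> T. f y < c"
    using assms unfolding usc_on_def by (metis subsetD)
  then show "\<exists>T. open T \<and> x \<in> T \<and> (\<forall>y\<in>S' \<inter> T. f y < c)"
    using assms(2) by (intro exI[of _ T]) auto
qed

lemma usc_on_cong:
  assumes "usc_on S f" "\<And>x. x \<in> S \<Longrightarrow> f x = g x"
  shows "usc_on S g"
  unfolding usc_on_def
proof (intro ballI allI impI)
  fix x c assume "x \<in> S" "g x < c"
  then obtain T where "open T" "x \<in> T" "\<forall>y\<in>S \<inter> T. f y < c"
    using assms unfolding usc_on_def by metis
  then show "\<exists>T. open T \<and> x \<in> T \<and> (\<forall>y\<in>S \<inter> T. g y < c)"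
    using assms(2) by (intro exI[of _ T]) auto
qed

lemma usc_on_compose:
  assumes "usc_on S f" "continuous_on UNIV E" "E ` D \<subseteq> S"
  shows "usc_on D (\<lambda>x. f (E x))"
  unfolding usc_on_def
proof (intro ballI allI impI)
  fix x c assume "x \<in> D" "f (E x) < c"
  then obtain T where T: "open T" "E x \<in> T" "\<forall>y\<in>S \<inter> T. f y < c"
    using assms(1,3) unfolding usc_on_def by blast
  have "open (E -` T)" using T(1) assms(2) by (simp add: open_vimage)
  then show "\<exists>T. open T \<and> x \<in> T \<and> (\<forall>y\<in>D \<inter> T. f (E y) < c)"
    using T assms(3) by (intro exI[of _ "E -` T"]) auto
qed

lemma usc_on_compact_bdd_above:
  assumes "compact C" "usc_on C f" and fin: "\<And>x. x \<in> C \<Longrightarrow> f x < \<infinity>"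
  shows "\<exists>c::real. \<forall>x\<in>C. f x \<le> ereal c"
proof -
  have "\<forall>x\<in>C. \<exists>T k. open T \<and> x \<in> T \<and> (\<forall>y\<in>C \<inter> T. f y < ereal k)"
  proof
    fix x assume x: "x \<in> C"
    obtain k where "f x < ereal k" using fin[OF x] ereal_dense2 by blast
    then show "\<exists>T k. open T \<and> x \<in> T \<and> (\<forall>y\<in>C \<inter> T. f y < ereal k)"
      using assms(2) x unfolding usc_on_def by blast
  qed
  then obtain T k where Tk: "\<And>x. x \<in> C \<Longrightarrow> open (T x)" "\<And>x. x \<in> C \<Longrightarrow> x \<in> T x"
    "\<And>x y. x \<in> C \<Longrightarrow> y \<in> C \<inter> T x \<Longrightarrow> f y < ereal (k x)" by metis
  obtain C' where C': "C' \<subseteq> C" "finite C'" "C \<subseteq> (\<Union>x\<in>C'. T x)"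
    using compactE_image[OF assms(1), of C T] Tk by blast
  have "f y \<le> ereal (Max (k ` C'))" if "y \<in> C" for y
  proof -
    obtain x where x: "x \<in> C'" "y \<in> T x" using C' \<open>y \<in> C\<close> by blast
    then have "f y < ereal (k x)" using Tk(3) C'(1) \<open>y \<in> C\<close> by blast
    also have "\<dots> \<le> ereal (Max (k ` C'))" using x C'(2) by auto
    finally show ?thesis by simp
  qed
  then show ?thesis by blast
qed

lemma subharmonic_onI:
  assumes fin: "\<And>z. z \<in> U \<Longrightarrow> f z < \<infinity>" and usc: "usc_on U f"
    and maj: "\<And>a r h z. 0 < r \<Longrightarrow> cball a r \<subseteq> U \<Longrightarrow> continuous_on (cball a r) h \<Longrightarrow> h holomorphic_on ball a r
      \<Longrightarrow> (\<forall>z\<in>sphere a r. f z \<le> ereal (Re (h z))) \<Longrightarrow> z \<in> cball a r \<Longrightarrow> f z \<le> ereal (Re (h z))"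
  shows "subharmonic_on U f"
  unfolding subharmonic_on_def
proof (intro conjI ballI allI impI)
  fix a r h z
  assume "0 < r" "cball a r \<subseteq> U" "continuous_on (cball a r) h" "h holomorphic_on ball a r"
    "\<forall>z\<in>sphere a r. f z \<le> ereal (Re (h z))" "z \<in> cball a r"
  then show "f z \<le> ereal (Re (h z))" by (rule maj)
qed (fact fin usc)+

lemma subharmonic_onD:
  assumes "subharmonic_on U f"
  shows "z \<in> U \<Longrightarrow> f z < \<infinity>" "usc_on U f"
    and "0 < r \<Longrightarrow> cball a r \<subseteq> U \<Longrightarrow> continuous_on (cball a r) h \<Longrightarrow> h holomorphic_on ball a r
      \<Longrightarrow> (\<forall>z\<in>sphere a r. f z \<le> ereal (Re (h z))) \<Longrightarrow> z \<in> cball a r \<Longrightarrow> f z \<le> ereal (Re (h z))"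
  using assms unfolding subharmonic_on_def by (simp, simp, metis)

lemma subharmonic_on_subset:
  assumes "subharmonic_on U f" "V \<subseteq> U"
  shows "subharmonic_on V f"
proof (rule subharmonic_onI)
  show "usc_on V f" by (rule usc_on_subset[OF subharmonic_onD(2)[OF assms(1)] assms(2)])
  show "f z < \<infinity>" if "z \<in> V" for z
    by (rule subharmonic_onD(1)[OF assms(1)]) (use assms(2) that in auto)
  show "f z \<le> ereal (Re (h z))"
    if "0 < r" "cball a r \<subseteq> V" "continuous_on (cball a r) h" "h holomorphic_on ball a r"
      "\<forall>z\<in>sphere a r. f z \<le> ereal (Re (h z))" "z \<in> cball a r" for a r h z
    by (rule subharmonic_onD(3)[OF assms(1) that(1) order_trans[OF that(2) assms(2)] that(3-6)])
qed

lemma subharmonic_on_cong: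
  assumes "subharmonic_on U f" and eq: "\<And>x. x \<in> U \<Longrightarrow> f x = g x"
  shows "subharmonic_on U g"
proof (rule subharmonic_onI)
  show "usc_on U g" by (rule usc_on_cong[OF subharmonic_onD(2)[OF assms(1)] eq])
  show "g z < \<infinity>" if "z \<in> U" for z using subharmonic_onD(1)[OF assms(1) that] eq[OF that] by simp
  show "g z \<le> ereal (Re (h z))"
    if *: "0 < r" "cball a r \<subseteq> U" "continuous_on (cball a r) h" "h holomorphic_on ball a r"
      "\<forall>z\<in>sphere a r. g z \<le> ereal (Re (h z))" "z \<in> cball a r" for a r h z
  proof -
    have "\<forall>z\<in>sphere a r. f z \<le> ereal (Re (h z))"
    proof
      fix z assume z: "z \<in> sphere a r"
      then have "z \<in> U" using *(2) by auto
      then show "f z \<le> ereal (Re (h z))" using *(5) z eq by simp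
    qed
    then have "f z \<le> ereal (Re (h z))"
      by (rule subharmonic_onD(3)[OF assms(1) *(1-4) _ *(6)])
    then show ?thesis using eq[of z] *(2,6) by auto
  qed
qed

lemma psh_on_cong:
  assumes "psh_on N \<Omega> f" "\<And>x. x \<in> \<Omega> \<Longrightarrow> f x = g x"
  shows "psh_on N \<Omega> g"
proof -
  have "subharmonic_on {l. cline a b l \<in> \<Omega>} (\<lambda>l. g (cline a b l))"
    if "a \<in> cspace N" "b \<in> cspace N" "b \<noteq> (\<lambda>_. 0)" for a b
    by (rule subharmonic_on_cong[of _ "\<lambda>l. f (cline a b l)"])
       (use assms that in \<open>auto simp: psh_on_def line_subharmonic_def\<close>)
  then show ?thesis
    using assms usc_on_cong[of \<Omega> f g] by (auto simp: psh_on_def line_subharmonic_def)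
qed

lemma continuous_on_cline: "continuous_on UNIV (cline a b)"
  unfolding cline_def by (intro continuous_on_coordinatewise_then_product continuous_intros)

lemma fun_upd_in_cspace: "x \<in> cspace N \<Longrightarrow> i < N \<Longrightarrow> x(i := l) \<in> cspace N"
  by (auto simp: cspace_def)

lemma line_subharmonic_coordinate:
  assumes "line_subharmonic N \<Omega> u" "x \<in> cspace N" "i < N"
  shows "subharmonic_on {l. x(i := l) \<in> \<Omega>} (\<lambda>l. u (x(i := l)))"
proof -
  define e :: "nat \<Rightarrow> complex" where "e = (\<lambda>_. 0)(i := 1)"
  have "e \<in> cspace N" using assms(3) by (auto simp: e_def cspace_def)
  moreover have "e \<noteq> (\<lambda>_. 0)" by (metis e_def fun_upd_same zero_neq_one)
  \<comment> \<open>Starting the line at coordinate value 0 makes the parameter the i-th coordinate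
    itself.\<close>
  moreover have "cline (x(i := 0)) e l = x(i := l)" for l by (auto simp: cline_def e_def)
  ultimately show ?thesis
    using assms fun_upd_in_cspace[of x N i 0] unfolding line_subharmonic_def by fastforce
qed

section \<open>Upper bounds on coordinate slices\<close>

lemma line_subharmonic_bdd_above_coordinate:
  assumes u: "line_subharmonic N \<Omega> u" and q: "q \<in> cspace N" "i < N"
    and C: "compact C" "C \<subseteq> \<Omega>" and slice: "\<And>x. x \<in> C \<Longrightarrow> x = q(i := x i)"
  shows "\<exists>c::real. \<forall>x\<in>C. u x \<le> ereal c"
proof -
  have sub: "subharmonic_on {l. q(i := l) \<in> \<Omega>} (\<lambda>l. u (q(i := l)))"
    by (rule line_subharmonic_coordinate[OF u q])
  define C1 where "C1 = (\<lambda>x. x i) ` C"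
  have "compact C1" unfolding C1_def
    by (rule compact_continuous_image[OF continuous_on_subset[OF continuous_on_product_coordinates] C(1)]) auto
  moreover have "C1 \<subseteq> {l. q(i := l) \<in> \<Omega>}"
    using slice C(2) unfolding C1_def by fastforce
  ultimately obtain c :: real where "\<forall>l\<in>C1. u (q(i := l)) \<le> ereal c"
    using usc_on_compact_bdd_above[of C1 "\<lambda>l. u (q(i := l))"] sub usc_on_subset
    unfolding subharmonic_on_def by blast
  then have "u x \<le> ereal c" if "x \<in> C" for x
    using slice[OF that] that unfolding C1_def by (metis imageI)
  then show ?thesis by blast
qed

text \<open>Filling in fixed coordinates from m on is affine and keeps directions: \<open>b\<close>
  vanishes from m on, so a line in C^m goes to a line in C^N with the same \<open>b\<close>.\<close>

lemma psh_on_embed: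
  assumes v: "psh_on N \<Omega> v" and "m \<le> N" and p: "p \<in> cspace N"
    and D: "D \<subseteq> cspace m" "\<And>x. x \<in> D \<Longrightarrow> (\<lambda>i. if i < m then x i else p i) \<in> \<Omega>"
  shows "psh_on m D (\<lambda>x. v (\<lambda>i. if i < m then x i else p i))"
proof -
  define E :: "(nat \<Rightarrow> complex) \<Rightarrow> (nat \<Rightarrow> complex)" where "E x = (\<lambda>i. if i < m then x i else p i)" for x
  have "continuous_on UNIV (\<lambda>x. E x i)" for i
    by (cases "i < m") (simp_all add: E_def)
  then have cont: "continuous_on UNIV E"
    by (rule continuous_on_coordinatewise_then_product)
  have sub: "E ` D \<subseteq> \<Omega>" using D(2) by (auto simp: E_def)
  have "subharmonic_on {l. cline a b l \<in> D} (\<lambda>l. v (E (cline a b l)))"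
    if "a \<in> cspace m" "b \<in> cspace m" "b \<noteq> (\<lambda>_. 0)" for a b
  proof -
    have eq: "E (cline a b l) = cline (E a) b l" for l
      using that(2) by (auto simp: E_def cline_def cspace_def)
    have "E a \<in> cspace N" "b \<in> cspace N" using that p \<open>m \<le> N\<close> by (auto simp: E_def cspace_def)
    then have "subharmonic_on {l. cline (E a) b l \<in> \<Omega>} (\<lambda>l. v (cline (E a) b l))"
      using v that(3) unfolding psh_on_def line_subharmonic_def by blast
    then show ?thesis unfolding eq
      by (rule subharmonic_on_subset) (use sub in \<open>auto simp: eq[symmetric]\<close>)
  qed
  then have "psh_on m D (\<lambda>x. v (E x))"
    using v sub usc_on_compose[OF _ cont sub] unfolding psh_on_def line_subharmonic_def by blast
  then show ?thesis unfolding E_def .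
qed

text \<open>Induction on the number m of free coordinates. With one free coordinate, v \<le> u and
  the semicontinuity of u on that line give the bound; the slices {x} \<times> G in the step are
  treated alike. The slices D \<times> {w} are the induction hypothesis with p changed at coordinate
  m, which is why p varies.\<close>

lemma loc_unif_bdd_above_coordinate_slices:
  assumes P: statement_P and u: "line_subharmonic N \<Omega> u"
    and U: "\<And>v. v \<in> \<U> \<Longrightarrow> psh_on N \<Omega> v" "\<And>v x. v \<in> \<U> \<Longrightarrow> x \<in> \<Omega> \<Longrightarrow> v x \<le> u x"
    and sub: "polydisc N z r \<subseteq> \<Omega>"
    and m: "1 \<le> m" "m \<le> N" and p: "p \<in> polydisc N z r"
  shows "loc_unif_bdd_above \<U> {x. (\<forall>i<m. dist (x i) (z i) < r) \<and> (\<forall>i\<ge>m. x i = p i)}"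
  using m p
proof (induction m arbitrary: p rule: dec_induct)
  case base
  show ?case unfolding loc_unif_bdd_above_def
  proof (intro allI impI, elim conjE)
    fix C assume C: "compact C" "C \<subseteq> {x. (\<forall>i<1. dist (x i) (z i) < r) \<and> (\<forall>i\<ge>1. x i = p i)}"
    have N: "0 < N" using base by simp
    have p: "p \<in> cspace N" using base polydisc_subset_cspace by blast
    have slice: "x = p(0 := x 0)" if "x \<in> C" for x
      using C(2) that by (force simp: fun_eq_iff Suc_le_eq)
    have "C \<subseteq> polydisc N z r"
    proof
      fix x assume x: "x \<in> C"
      then have "dist (x 0) (z 0) < r" "\<forall>i\<ge>1. x i = p i" using C(2) by auto
      then have "dist (x i) (z i) < r" if "i < N" for i
        using that base.prems unfolding polydisc_def by (cases i) auto
      moreover have "x \<in> cspace N" using p N \<open>\<forall>i\<ge>1. x i = p i\<close> by (auto simp: cspace_def)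
      ultimately show "x \<in> polydisc N z r" by (simp add: polydisc_def)
    qed
    then have C\<Omega>: "C \<subseteq> \<Omega>" using sub by blast
    from line_subharmonic_bdd_above_coordinate[OF u p N C(1) this slice]
    show "\<exists>c::real. \<forall>v\<in>\<U>. \<forall>x\<in>C. v x \<le> ereal c" using U(2) C\<Omega> by (meson order_trans subsetD)
  qed
next
  case (step m)
  have p: "p \<in> cspace N" "\<And>i. i < N \<Longrightarrow> dist (p i) (z i) < r"
    using step.prems by (auto simp: polydisc_def)
  have mN: "m < N" "Suc m \<le> N" "1 \<le> m" using step by auto
  define D where "D = polydisc m z r"
  define G where "G = polydisc 1 (\<lambda>_. z m) r"
  define W where "W = (\<lambda>(x, w). cjoin m x w) ` (D \<times> G)"
  define E :: "(nat \<Rightarrow> complex) \<Rightarrow> (nat \<Rightarrow> complex)" where "E x = (\<lambda>i. if i < Suc m then x i else p i)" for x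
  define \<V> where "\<V> = (\<lambda>v x. v (E x)) ` \<U>"
  have "continuous_on UNIV (\<lambda>x. E x i)" for i
    by (cases "i < Suc m") (simp_all add: E_def)
  then have contE: "continuous_on S E" for S
    using continuous_on_coordinatewise_then_product continuous_on_subset by blast
  have E_join: "E (cjoin m x w) = (\<lambda>i. if i < m then x i else (p(m := w 0)) i)" for x w
    by (auto simp: E_def cjoin_def less_Suc_eq)
  have G: "dist (w 0) (z m) < r" if "w \<in> G" for w using that by (simp add: G_def polydisc_def)
  have D: "dist (x i) (z i) < r" if "x \<in> D" "i < m" for x i using that by (simp add: D_def polydisc_def)
  have E\<Omega>: "E (cjoin m x w) \<in> \<Omega>" if "x \<in> D" "w \<in> G" for x w
  proof -
    have "E (cjoin m x w) \<in> polydisc N z r"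
      unfolding E_join using p mN D[OF that(1)] G[OF that(2)] by (auto simp: polydisc_def cspace_def)
    then show ?thesis using sub by blast
  qed
  have W: "W \<subseteq> cspace (Suc m)"
    by (auto simp: W_def cjoin_def cspace_def G_def polydisc_def)
  have psh: "\<forall>v\<in>\<V>. psh_on (m + 1) W v"
  proof
    fix v assume "v \<in> \<V>"
    then obtain v' where v': "v' \<in> \<U>" "v = (\<lambda>x. v' (E x))" by (auto simp: \<V>_def)
    have "psh_on (Suc m) W (\<lambda>x. v' (E x))"
      unfolding E_def
      by (rule psh_on_embed[OF U(1)[OF v'(1)] mN(2) p(1) W]) (use E\<Omega> in \<open>auto simp: W_def E_def\<close>)
    then show "psh_on (m + 1) W v" using v'(2) by simp
  qed
  have slice1: "loc_unif_bdd_above \<V> ((\<lambda>x. cjoin m x w) ` D)" if w: "w \<in> G" for w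
    unfolding loc_unif_bdd_above_def
  proof (intro allI impI, elim conjE)
    fix C assume C: "compact C" "C \<subseteq> (\<lambda>x. cjoin m x w) ` D"
    have "p(m := w 0) \<in> polydisc N z r"
      using p mN G[OF w] by (auto simp: polydisc_def cspace_def)
    then have "loc_unif_bdd_above \<U> {x. (\<forall>i<m. dist (x i) (z i) < r) \<and> (\<forall>i\<ge>m. x i = (p(m := w 0)) i)}"
      using step.IH[of "p(m := w 0)"] mN by (simp del: fun_upd_apply)
    moreover have "compact (E ` C)" by (rule compact_continuous_image[OF contE C(1)])
    moreover have "E ` C \<subseteq> {x. (\<forall>i<m. dist (x i) (z i) < r) \<and> (\<forall>i\<ge>m. x i = (p(m := w 0)) i)}"
      using C(2) D by (fastforce simp: E_join)
    ultimately obtain c :: real where "\<forall>v\<in>\<U>. \<forall>x\<in>E ` C. v x \<le> ereal c"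
      unfolding loc_unif_bdd_above_def by meson
    then show "\<exists>c::real. \<forall>v\<in>\<V>. \<forall>x\<in>C. v x \<le> ereal c" by (auto simp: \<V>_def)
  qed
  have slice2: "loc_unif_bdd_above \<V> ((\<lambda>w. cjoin m x w) ` G)" if x: "x \<in> D" for x
    unfolding loc_unif_bdd_above_def
  proof (intro allI impI, elim conjE)
    fix C assume C: "compact C" "C \<subseteq> (\<lambda>w. cjoin m x w) ` G"
    define q where "q = (\<lambda>i. if i < m then x i else p i)"
    have q: "q \<in> cspace N" using p mN by (auto simp: q_def cspace_def)
    have "compact (E ` C)" by (rule compact_continuous_image[OF contE C(1)])
    moreover have EC: "E ` C \<subseteq> \<Omega>" using C(2) E\<Omega>[OF x] by blast
    moreover have "y = q(m := y m)" if "y \<in> E ` C" for y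
      using that C(2) by (auto simp: E_join q_def fun_eq_iff)
    ultimately obtain c :: real where c: "\<forall>y\<in>E ` C. u y \<le> ereal c"
      using line_subharmonic_bdd_above_coordinate[OF u q mN(1)] by blast
    have "v' (E x) \<le> ereal c" if "v' \<in> \<U>" "x \<in> C" for v' x
    proof -
      have "v' (E x) \<le> u (E x)" by (rule U(2)[OF that(1)]) (use EC that(2) in auto)
      also have "\<dots> \<le> ereal c" using c that(2) by auto
      finally show ?thesis .
    qed
    then show "\<exists>c::real. \<forall>v\<in>\<V>. \<forall>x\<in>C. v x \<le> ereal c" by (auto simp: \<V>_def)
  qed
  have "cdomain m D" "cdomain 1 G"
    by (simp_all add: cdomain_def D_def G_def copen_polydisc connected_polydisc)
  then have bdd: "loc_unif_bdd_above \<V> W"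
    using P[unfolded statement_P_def, rule_format, of m 1 D G \<V>] mN(3) psh slice1 slice2
    unfolding W_def by auto
  show ?case unfolding loc_unif_bdd_above_def
  proof (intro allI impI, elim conjE)
    fix C assume C: "compact C" "C \<subseteq> {x. (\<forall>i<Suc m. dist (x i) (z i) < r) \<and> (\<forall>i\<ge>Suc m. x i = p i)}"
    \<comment> \<open>Truncation is undone by \<open>E\<close> on \<open>C\<close>, since there the
      dropped coordinates are those of p. It turns \<open>C\<close> into a compact subset of
      \<open>W\<close>.\<close>
    define Tr :: "(nat \<Rightarrow> complex) \<Rightarrow> (nat \<Rightarrow> complex)" where "Tr x = (\<lambda>i. if i < Suc m then x i else 0)" for x
    have "continuous_on UNIV (\<lambda>x. Tr x i)" for i
      by (cases "i < Suc m") (simp_all add: Tr_def)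
    then have "continuous_on C Tr"
      using continuous_on_coordinatewise_then_product continuous_on_subset by blast
    then have "compact (Tr ` C)" using C(1) by (rule compact_continuous_image)
    moreover have "Tr ` C \<subseteq> W"
    proof
      fix y assume "y \<in> Tr ` C"
      then obtain x where x: "x \<in> C" "y = Tr x" by blast
      define x1 where "x1 = (\<lambda>i. if i < m then x i else 0)"
      define w1 :: "nat \<Rightarrow> complex" where "w1 = (\<lambda>i. if i = 0 then x m else 0)"
      have "y = cjoin m x1 w1" by (auto simp: x(2) Tr_def cjoin_def x1_def w1_def fun_eq_iff less_Suc_eq)
      moreover have "x1 \<in> D" "w1 \<in> G" using C(2) x(1)
        by (auto simp: x1_def w1_def D_def G_def polydisc_def cspace_def)
      ultimately show "y \<in> W" by (auto simp: W_def)
    qed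
    ultimately obtain c :: real where c: "\<forall>v\<in>\<V>. \<forall>x\<in>Tr ` C. v x \<le> ereal c"
      using bdd unfolding loc_unif_bdd_above_def by meson
    have "E (Tr x) = x" if "x \<in> C" for x
      using C(2) that by (auto simp: E_def Tr_def fun_eq_iff)
    then have "v x \<le> ereal c" if "v \<in> \<U>" "x \<in> C" for v x
      using c that unfolding \<V>_def by (metis (no_types, lifting) imageI)
    then have "\<forall>v\<in>\<U>. \<forall>x\<in>C. v x \<le> ereal c" by blast
    then show "\<exists>c::real. \<forall>v\<in>\<U>. \<forall>x\<in>C. v x \<le> ereal c" by blast
  qed
qed

lemma psh_minorants_bdd_above_polydisc:
  assumes P: statement_P and \<Omega>: "copen N \<Omega>" and u: "\<forall>z\<in>\<Omega>. u z < \<infinity>" "line_subharmonic N \<Omega> u"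
    and U: "\<And>v. v \<in> \<U> \<Longrightarrow> psh_on N \<Omega> v" "\<And>v x. v \<in> \<U> \<Longrightarrow> x \<in> \<Omega> \<Longrightarrow> v x \<le> u x"
    and z: "z \<in> \<Omega>"
  shows "\<exists>R>0. polydisc N z R \<subseteq> \<Omega> \<and> (\<exists>K::real. \<forall>v\<in>\<U>. \<forall>y\<in>polydisc N z R. v y \<le> ereal K)"
proof -
  obtain r where r: "r > 0" "polydisc N z r \<subseteq> \<Omega>" using copen_contains_polydisc[OF \<Omega> z] by blast
  have zc: "z \<in> cspace N" using z copen_subset_cspace[OF \<Omega>] by blast
  show ?thesis
  proof (cases "N = 0")
    \<comment> \<open>The induction above starts with one free coordinate. For N = 0 the polydisc is
      a single point, where u itself is the bound.\<close>
    case True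
    have "polydisc N z r = {z}" using zc by (auto simp: True polydisc_def cspace_def)
    moreover obtain K where "u z \<le> ereal K" using u z by (cases "u z") auto
    ultimately show ?thesis using r U(2) z by (metis order_trans singletonD)
  next
    case False
    have "loc_unif_bdd_above \<U> {x. (\<forall>i<N. dist (x i) (z i) < r) \<and> (\<forall>i\<ge>N. x i = z i)}"
      by (rule loc_unif_bdd_above_coordinate_slices[OF P u(2) _ _ r(2)])
         (use U False center_in_polydisc[OF zc r(1)] in auto)
    moreover have "{y \<in> cspace N. \<forall>i<N. dist (y i) (z i) \<le> r / 2}
        \<subseteq> {x. (\<forall>i<N. dist (x i) (z i) < r) \<and> (\<forall>i\<ge>N. x i = z i)}"
      using r(1) zc by (force simp: cspace_def)
    ultimately obtain K :: real where
      "\<forall>v\<in>\<U>. \<forall>y\<in>{y \<in> cspace N. \<forall>i<N. dist (y i) (z i) \<le> r / 2}. v y \<le> ereal K"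
      unfolding loc_unif_bdd_above_def using compact_closed_polydisc by meson
    then have "\<forall>v\<in>\<U>. \<forall>y\<in>polydisc N z (r / 2). v y \<le> ereal K"
      by (auto simp: polydisc_def less_imp_le)
    moreover have "polydisc N z (r / 2) \<subseteq> \<Omega>" using r polydisc_mono[of "r / 2" r N z] by auto
    ultimately show ?thesis using r(1) by (intro exI[of _ "r / 2"]) auto
  qed
qed

subsection \<open>Upper semicontinuous regularization\<close>

text \<open>The limit superior at z with z itself included, which puts it above s on \<Omega>. Only
  points of \<Omega> enter, because \<open>psh_on\<close> says nothing about values
  elsewhere.\<close>

definition usc_reg :: "nat \<Rightarrow> (nat \<Rightarrow> complex) set \<Rightarrow> ((nat \<Rightarrow> complex) \<Rightarrow> ereal) \<Rightarrow> (nat \<Rightarrow> complex) \<Rightarrow> ereal" where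
  "usc_reg N \<Omega> s z = (INF r\<in>{0<..}. SUP y\<in>\<Omega> \<inter> polydisc N z r. s y)"

lemma usc_reg_lessE:
  assumes "usc_reg N \<Omega> s z < c"
  obtains r where "0 < r" "(SUP y\<in>\<Omega> \<inter> polydisc N z r. s y) < c"
  using assms unfolding usc_reg_def by (auto simp: INF_less_iff)

lemma usc_reg_le_SUP: "0 < r \<Longrightarrow> usc_reg N \<Omega> s z \<le> (SUP y\<in>\<Omega> \<inter> polydisc N z r. s y)"
  unfolding usc_reg_def by (intro INF_lower) auto

lemma usc_reg_ge:
  assumes "z \<in> \<Omega>" "\<Omega> \<subseteq> cspace N"
  shows "s z \<le> usc_reg N \<Omega> s z"
  unfolding usc_reg_def using assms center_in_polydisc
  by (intro INF_greatest SUP_upper) auto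

lemma usc_on_usc_reg:
  assumes "\<Omega> \<subseteq> cspace N"
  shows "usc_on \<Omega> (usc_reg N \<Omega> s)"
  unfolding usc_on_def
proof (intro ballI allI impI)
  fix z c assume z: "z \<in> \<Omega>" and c: "usc_reg N \<Omega> s z < c"
  obtain r where r: "0 < r" "(SUP y\<in>\<Omega> \<inter> polydisc N z r. s y) < c"
    using usc_reg_lessE[OF c] .
  obtain T where T: "open T" "polydisc N z (r / 2) = cspace N \<inter> T"
    using polydisc_eq_open_Int by blast
  have zc: "z \<in> cspace N" using z assms by auto
  have "z \<in> T" using center_in_polydisc[OF zc, of "r / 2"] r(1) T(2) by auto
  moreover have "usc_reg N \<Omega> s y < c" if y: "y \<in> \<Omega> \<inter> T" for y
  proof -
    have "y \<in> polydisc N z (r / 2)" using y T(2) assms by auto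
    then have sub: "polydisc N y (r / 2) \<subseteq> polydisc N z r" by (rule polydisc_half_subset)
    have "usc_reg N \<Omega> s y \<le> (SUP y\<in>\<Omega> \<inter> polydisc N y (r / 2). s y)"
      using r(1) by (intro usc_reg_le_SUP) auto
    also have "\<dots> \<le> (SUP y\<in>\<Omega> \<inter> polydisc N z r. s y)"
      using sub by (intro SUP_subset_mono) auto
    finally show ?thesis using r(2) by simp
  qed
  ultimately show "\<exists>T. open T \<and> z \<in> T \<and> (\<forall>y\<in>\<Omega> \<inter> T. usc_reg N \<Omega> s y < c)"
    using T(1) by blast
qed

text \<open>A Lebesgue number argument: \<open>P r\<close> stands for the perturbations of size r,
  and \<open>Q d y\<close> for what is wanted at y after the perturbation d. Monotonicity of P
  allows passing to the least radius of a finite subcover.\<close>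

lemma compact_uniform_radius:
  fixes S :: "'a::metric_space set"
  assumes S: "compact S"
    and mono: "\<And>r r' d. 0 < r \<Longrightarrow> r \<le> r' \<Longrightarrow> d \<in> P r \<Longrightarrow> d \<in> P r'"
    and loc: "\<And>x. x \<in> S \<Longrightarrow> \<exists>\<eta>>0. \<forall>y\<in>S. dist x y < \<eta> \<longrightarrow> (\<forall>d\<in>P \<eta>. Q d y)"
  shows "\<exists>\<delta>>0::real. \<forall>y\<in>S. \<forall>d\<in>P \<delta>. Q d y"
proof -
  obtain \<eta> where \<eta>: "\<And>x. x \<in> S \<Longrightarrow> \<eta> x > 0"
    "\<And>x y d. x \<in> S \<Longrightarrow> y \<in> S \<Longrightarrow> dist x y < \<eta> x \<Longrightarrow> d \<in> P (\<eta> x) \<Longrightarrow> Q d y"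
    using loc by metis
  obtain S' where S': "S' \<subseteq> S" "finite S'" "S \<subseteq> (\<Union>x\<in>S'. ball x (\<eta> x))"
  proof (rule compactE_image[OF S, of S "\<lambda>x. ball x (\<eta> x)"])
    show "S \<subseteq> (\<Union>x\<in>S. ball x (\<eta> x))" using \<eta>(1) by (auto intro!: bexI)
  qed auto
  define \<delta> where "\<delta> = Min (insert 1 (\<eta> ` S'))"
  have \<delta>: "\<delta> > 0" using S' \<eta>(1) by (auto simp: \<delta>_def)
  have "Q d y" if "y \<in> S" "d \<in> P \<delta>" for d y
  proof -
    obtain x where x: "x \<in> S'" "dist x y < \<eta> x" using S' \<open>y \<in> S\<close> by auto
    have "\<delta> \<le> \<eta> x" using x(1) S'(2) by (auto simp: \<delta>_def)
    then have "d \<in> P (\<eta> x)" using mono[OF \<delta>] that by blast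
    then show ?thesis using \<eta>(2)[of x y d] x that S'(1) by blast
  qed
  then show ?thesis using \<delta> by blast
qed

lemma cline_perturb_in_polydisc:
  assumes a: "a \<in> cspace N" and b: "b \<in> cspace N" and \<kappa>: "0 < \<kappa>"
  shows "\<exists>\<eta>>0. \<forall>d\<in>polydisc N (\<lambda>_. 0) \<eta>. \<forall>t'. dist t t' < \<eta> \<longrightarrow>
      cline (\<lambda>i. a i + d i) b t' \<in> polydisc N (cline a b t) \<kappa>"
proof -
  define B where "B = (\<Sum>i<N. norm (b i))"
  have B: "B \<ge> 0" by (simp add: B_def sum_nonneg)
  \<comment> \<open>The displacement in each coordinate is below \<eta> for the translation plus at
    most \<eta> * B for the change of parameter, together \<kappa>.\<close>
  define \<eta> where "\<eta> = \<kappa> / (1 + B)"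
  have \<eta>: "\<eta> > 0" using \<kappa> B by (simp add: \<eta>_def)
  have "cline (\<lambda>i. a i + d i) b t' \<in> polydisc N (cline a b t) \<kappa>"
    if d: "d \<in> polydisc N (\<lambda>_. 0) \<eta>" and l: "dist t t' < \<eta>" for d t'
  proof -
    have "dist (cline (\<lambda>i. a i + d i) b t' i) (cline a b t i) < \<kappa>" if i: "i < N" for i
    proof -
      have "dist (cline (\<lambda>i. a i + d i) b t' i) (cline a b t i) = norm (d i + (t' - t) * b i)"
        by (simp add: cline_def dist_norm algebra_simps)
      also have "\<dots> \<le> norm (d i) + norm (t' - t) * norm (b i)"
        by (metis norm_mult norm_triangle_ineq)
      also have "norm (t' - t) * norm (b i) \<le> \<eta> * B"
      proof (rule mult_mono)
        show "norm (b i) \<le> B" unfolding B_def using i by (intro member_le_sum) auto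
      qed (use l \<eta> in \<open>auto simp: dist_norm norm_minus_commute\<close>)
      also have "norm (d i) < \<eta>" using d i by (auto simp: polydisc_def)
      finally have "dist (cline (\<lambda>i. a i + d i) b t' i) (cline a b t i) < \<eta> * (1 + B)"
        by (simp add: algebra_simps)
      then show ?thesis using B by (simp add: \<eta>_def)
    qed
    moreover have "cline (\<lambda>i. a i + d i) b t' \<in> cspace N"
      using a b d by (auto simp: cline_def cspace_def polydisc_def)
    ultimately show ?thesis by (simp add: polydisc_def)
  qed
  then show ?thesis using \<eta> by blast
qed

text \<open>The harmonic majorant property passes to the regularization because a disc that
  compactly fits into \<open>\<Omega>\<close> may be translated slightly, with a small loss in the majorant.\<close>
lemma psh_on_usc_reg_SUP:
  assumes \<Omega>: "copen N \<Omega>" and U: "\<And>v. v \<in> \<U> \<Longrightarrow> psh_on N \<Omega> v"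
    and bdd: "\<And>z. z \<in> \<Omega> \<Longrightarrow> \<exists>R>0. \<exists>K::real. \<forall>v\<in>\<U>. \<forall>y\<in>\<Omega> \<inter> polydisc N z R. v y \<le> ereal K"
  shows "psh_on N \<Omega> (usc_reg N \<Omega> (\<lambda>z. SUP v\<in>\<U>. v z))"
proof -
  define s where "s z = (SUP v\<in>\<U>. v z)" for z
  define g where "g = usc_reg N \<Omega> s"
  have \<Omega>c: "\<Omega> \<subseteq> cspace N" by (rule copen_subset_cspace[OF \<Omega>])
  have fin: "g z < \<infinity>" if z: "z \<in> \<Omega>" for z
  proof -
    obtain R K where R: "R > 0" "\<And>v y. v \<in> \<U> \<Longrightarrow> y \<in> \<Omega> \<inter> polydisc N z R \<Longrightarrow> v y \<le> ereal K"
      using bdd[OF z] by blast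
    have "g z \<le> (SUP y\<in>\<Omega> \<inter> polydisc N z R. s y)" unfolding g_def by (rule usc_reg_le_SUP[OF R(1)])
    also have "\<dots> \<le> ereal K" unfolding s_def by (intro SUP_least R(2))
    finally show ?thesis by (rule order_le_less_trans) simp
  qed
  have usc: "usc_on \<Omega> g" unfolding g_def by (rule usc_on_usc_reg[OF \<Omega>c])
  have line: "subharmonic_on {l. cline a b l \<in> \<Omega>} (\<lambda>l. g (cline a b l))"
    if a: "a \<in> cspace N" and b: "b \<in> cspace N" "b \<noteq> (\<lambda>_. 0)" for a b
  proof (rule subharmonic_onI)
    show "g (cline a b z) < \<infinity>" if "z \<in> {l. cline a b l \<in> \<Omega>}" for z using fin that by blast
    show "usc_on {l. cline a b l \<in> \<Omega>} (\<lambda>l. g (cline a b l))"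
      by (rule usc_on_compose[OF usc continuous_on_cline]) auto
    fix c r h t0
    assume r: "0 < r" and cb: "cball c r \<subseteq> {l. cline a b l \<in> \<Omega>}"
      and h: "continuous_on (cball c r) h" "h holomorphic_on ball c r"
      and maj: "\<forall>z\<in>sphere c r. g (cline a b z) \<le> ereal (Re (h z))" and t0: "t0 \<in> cball c r"
    show "g (cline a b t0) \<le> ereal (Re (h t0))"
    proof (rule ereal_le_epsilon2)
      fix e :: real assume e: "0 < e"
      have pmono: "d \<in> polydisc N (\<lambda>_. 0) r'" if "d \<in> polydisc N (\<lambda>_. 0) r" "r \<le> r'" for d and r r' :: real
        using polydisc_mono that by blast
      \<comment> \<open>The translated closed discs must stay in \<Omega> before the majorant
        property of a single \<open>v\<close> can be used on them.\<close>
      have "\<exists>\<delta>>0. \<forall>t\<in>cball c r. \<forall>d\<in>polydisc N (\<lambda>_. 0) \<delta>. cline (\<lambda>i. a i + d i) b t \<in> \<Omega>"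
      proof (rule compact_uniform_radius)
        fix t assume t: "t \<in> cball c r"
        obtain \<kappa> where \<kappa>: "\<kappa> > 0" "polydisc N (cline a b t) \<kappa> \<subseteq> \<Omega>"
          using copen_contains_polydisc[OF \<Omega>, of "cline a b t"] cb t by blast
        show "\<exists>\<eta>>0. \<forall>y\<in>cball c r. dist t y < \<eta> \<longrightarrow> (\<forall>d\<in>polydisc N (\<lambda>_. 0) \<eta>. cline (\<lambda>i. a i + d i) b y \<in> \<Omega>)"
          using cline_perturb_in_polydisc[OF a b(1) \<kappa>(1), of t] \<kappa>(2) by (meson subsetD)
      qed (use pmono in auto)
      then obtain \<delta>1 where \<delta>1: "\<delta>1 > 0"
        "\<And>t d. t \<in> cball c r \<Longrightarrow> d \<in> polydisc N (\<lambda>_. 0) \<delta>1 \<Longrightarrow> cline (\<lambda>i. a i + d i) b t \<in> \<Omega>" by blast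
      \<comment> \<open>Half of e comes from the strict inequality for the regularization at t,
        which bounds s on a whole polydisc, and half from the continuity of h.\<close>
      have "\<exists>\<delta>>0. \<forall>t\<in>sphere c r. \<forall>d\<in>polydisc N (\<lambda>_. 0) \<delta>.
          cline (\<lambda>i. a i + d i) b t \<in> \<Omega> \<longrightarrow> s (cline (\<lambda>i. a i + d i) b t) \<le> ereal (Re (h t) + e)"
      proof (rule compact_uniform_radius)
        fix t assume t: "t \<in> sphere c r"
        have "g (cline a b t) < ereal (Re (h t) + e / 2)"
        proof (rule order_le_less_trans)
          show "g (cline a b t) \<le> ereal (Re (h t))" using maj t by blast
        qed (use e in simp)
        then obtain \<kappa> where \<kappa>: "0 < \<kappa>"
          "(SUP y\<in>\<Omega> \<inter> polydisc N (cline a b t) \<kappa>. s y) < ereal (Re (h t) + e / 2)"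
          unfolding g_def by (rule usc_reg_lessE)
        obtain \<eta>1 where \<eta>1: "\<eta>1 > 0" "\<And>d y. d \<in> polydisc N (\<lambda>_. 0) \<eta>1 \<Longrightarrow> dist t y < \<eta>1 \<Longrightarrow>
            cline (\<lambda>i. a i + d i) b y \<in> polydisc N (cline a b t) \<kappa>"
          using cline_perturb_in_polydisc[OF a b(1) \<kappa>(1), of t] by blast
        have "t \<in> cball c r" using t by auto
        then obtain \<eta>2 where \<eta>2: "\<eta>2 > 0"
          "\<And>y. y \<in> cball c r \<Longrightarrow> dist y t < \<eta>2 \<Longrightarrow> dist (h y) (h t) < e / 2"
          using h(1) e unfolding continuous_on_iff by (metis half_gt_zero)
        have "s (cline (\<lambda>i. a i + d i) b y) \<le> ereal (Re (h y) + e)"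
          if "y \<in> sphere c r" "dist t y < min \<eta>1 \<eta>2" "d \<in> polydisc N (\<lambda>_. 0) (min \<eta>1 \<eta>2)"
            "cline (\<lambda>i. a i + d i) b y \<in> \<Omega>" for y d
        proof -
          have "d \<in> polydisc N (\<lambda>_. 0) \<eta>1" using pmono[OF that(3), of \<eta>1] by simp
          then have "cline (\<lambda>i. a i + d i) b y \<in> \<Omega> \<inter> polydisc N (cline a b t) \<kappa>"
            using \<eta>1(2) that by simp
          then have "s (cline (\<lambda>i. a i + d i) b y) \<le> (SUP y\<in>\<Omega> \<inter> polydisc N (cline a b t) \<kappa>. s y)"
            by (rule SUP_upper)
          also have "\<dots> \<le> ereal (Re (h t) + e / 2)" using \<kappa>(2) by simp
          also have "\<dots> \<le> ereal (Re (h y) + e)"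
          proof -
            have "dist (h y) (h t) < e / 2" using \<eta>2(2)[of y] that(1,2) by (simp add: dist_commute)
            then have "\<bar>Re (h y) - Re (h t)\<bar> < e / 2"
              using abs_Re_le_cmod[of "h y - h t"] by (simp add: dist_norm)
            then show ?thesis unfolding ereal_less_eq(3) by linarith
          qed
          finally show ?thesis .
        qed
        then show "\<exists>\<eta>>0. \<forall>y\<in>sphere c r. dist t y < \<eta> \<longrightarrow> (\<forall>d\<in>polydisc N (\<lambda>_. 0) \<eta>.
            cline (\<lambda>i. a i + d i) b y \<in> \<Omega> \<longrightarrow> s (cline (\<lambda>i. a i + d i) b y) \<le> ereal (Re (h y) + e))"
          using \<eta>1(1) \<eta>2(1) by (intro exI[of _ "min \<eta>1 \<eta>2"]) auto
      qed (use pmono in auto)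
      then obtain \<delta>2 where \<delta>2: "\<delta>2 > 0"
        "\<And>t d. t \<in> sphere c r \<Longrightarrow> d \<in> polydisc N (\<lambda>_. 0) \<delta>2 \<Longrightarrow> cline (\<lambda>i. a i + d i) b t \<in> \<Omega> \<Longrightarrow>
          s (cline (\<lambda>i. a i + d i) b t) \<le> ereal (Re (h t) + e)" by blast
      define \<delta> where "\<delta> = min \<delta>1 \<delta>2"
      have \<delta>: "\<delta> > 0" using \<delta>1 \<delta>2 by (simp add: \<delta>_def)
      have "v y \<le> ereal (Re (h t0) + e)"
        if y: "y \<in> \<Omega> \<inter> polydisc N (cline a b t0) \<delta>" and v: "v \<in> \<U>" for y v
      proof -
        \<comment> \<open>The translation that brings the line to \<open>y\<close> at parameter
          \<open>t0\<close>. As \<delta> was chosen before \<open>v\<close> and \<open>y\<close>,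
          the resulting bound passes to the supremum over both.\<close>
        define d where "d i = y i - cline a b t0 i" for i
        have d: "d \<in> polydisc N (\<lambda>_. 0) \<delta>"
          using y a b by (auto simp: d_def polydisc_def cspace_def cline_def dist_norm)
        have d1: "d \<in> polydisc N (\<lambda>_. 0) \<delta>1" and d2: "d \<in> polydisc N (\<lambda>_. 0) \<delta>2"
          using pmono[OF d] by (auto simp: \<delta>_def)
        have ad: "(\<lambda>i. a i + d i) \<in> cspace N" using a d by (auto simp: polydisc_def cspace_def)
        have sub: "subharmonic_on {l. cline (\<lambda>i. a i + d i) b l \<in> \<Omega>} (\<lambda>l. v (cline (\<lambda>i. a i + d i) b l))"
          using U[OF v] ad b unfolding psh_on_def line_subharmonic_def by blast
        have "v (cline (\<lambda>i. a i + d i) b t0) \<le> ereal (Re (h t0 + of_real e))"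
        proof (rule subharmonic_onD(3)[OF sub r _ _ _ _ t0])
          show "cball c r \<subseteq> {l. cline (\<lambda>i. a i + d i) b l \<in> \<Omega>}" using \<delta>1(2) d1 by blast
          show "continuous_on (cball c r) (\<lambda>x. h x + of_real e)" by (intro continuous_intros h)
          show "(\<lambda>x. h x + of_real e) holomorphic_on ball c r" by (intro holomorphic_intros h)
          show "\<forall>z\<in>sphere c r. v (cline (\<lambda>i. a i + d i) b z) \<le> ereal (Re (h z + of_real e))"
          proof
            fix z assume z: "z \<in> sphere c r"
            have "cline (\<lambda>i. a i + d i) b z \<in> \<Omega>" using \<delta>1(2)[OF _ d1] z by auto
            then have "s (cline (\<lambda>i. a i + d i) b z) \<le> ereal (Re (h z) + e)" by (rule \<delta>2(2)[OF z d2])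
            moreover have "v (cline (\<lambda>i. a i + d i) b z) \<le> s (cline (\<lambda>i. a i + d i) b z)"
              unfolding s_def by (rule SUP_upper[OF v])
            ultimately show "v (cline (\<lambda>i. a i + d i) b z) \<le> ereal (Re (h z + of_real e))"
              using order_trans by simp
          qed
        qed
        moreover have "cline (\<lambda>i. a i + d i) b t0 = y" by (auto simp: cline_def d_def)
        ultimately show ?thesis by simp
      qed
      then have "(SUP y\<in>\<Omega> \<inter> polydisc N (cline a b t0) \<delta>. s y) \<le> ereal (Re (h t0) + e)"
        unfolding s_def by (intro SUP_least)
      then show "g (cline a b t0) \<le> ereal (Re (h t0)) + ereal e"
        using usc_reg_le_SUP[OF \<delta>, of N \<Omega> s "cline a b t0"] unfolding g_def by simp
    qed
  qed
  have "psh_on N \<Omega> g" unfolding psh_on_def line_subharmonic_def using fin usc line by blast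
  then show ?thesis unfolding g_def s_def .
qed

subsection \<open>Iterated means over tori\<close>

text \<open>Iterated integrals instead of a product measure let the one-variable Harnack inequality
  enter by induction on the coordinates. The entries of x below n are overwritten.\<close>

primrec torus_mean :: "nat \<Rightarrow> ((nat \<Rightarrow> complex) \<Rightarrow> ennreal) \<Rightarrow> (nat \<Rightarrow> complex) \<Rightarrow> ennreal" where
  "torus_mean 0 F x = F x"
| "torus_mean (Suc n) F x = (\<integral>\<^sup>+s. torus_mean n F (x(n := cis (2 * pi * s))) \<partial>unit_interval)"

lemma emeasure_unit_interval: "emeasure unit_interval {0..1} = 1"
  by (simp add: emeasure_restrict_space)

lemma continuous_on_fun_upd_cis:
  "continuous_on UNIV (\<lambda>p :: (nat \<Rightarrow> complex) \<times> real. (fst p)(n := cis (2 * pi * snd p)))"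
proof (rule continuous_on_coordinatewise_then_product)
  fix i
  have "continuous_on UNIV (\<lambda>p :: (nat \<Rightarrow> complex) \<times> real. fst p i)"
    by (rule continuous_on_product_then_coordinatewise) (intro continuous_intros)
  moreover have "continuous_on UNIV (\<lambda>p :: (nat \<Rightarrow> complex) \<times> real. cis (2 * pi * snd p))"
    by (intro continuous_intros)
  ultimately show "continuous_on UNIV (\<lambda>p :: (nat \<Rightarrow> complex) \<times> real. ((fst p)(n := cis (2 * pi * snd p))) i)"
    by (cases "i = n") simp_all
qed

text \<open>Joint measurability in point and angle makes each inner integral a measurable function
  of the remaining coordinates.\<close>

lemma measurable_fun_upd_cis:
  fixes F :: "(nat \<Rightarrow> complex) \<Rightarrow> ennreal"
  assumes "F \<in> borel_measurable borel"
  shows "(\<lambda>p. F ((fst p)(n := cis (2 * pi * snd p)))) \<in> borel_measurable (borel \<Otimes>\<^sub>M unit_interval)"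
proof -
  have 1: "(\<lambda>p :: (nat \<Rightarrow> complex) \<times> real. F ((fst p)(n := cis (2 * pi * snd p)))) \<in> borel_measurable borel"
    by (rule measurable_compose[OF borel_measurable_continuous_onI[OF continuous_on_fun_upd_cis] assms])
  have "(\<lambda>x. x) \<in> measurable unit_interval borel"
    by (intro measurable_restrict_space1) simp
  from measurable_compose[OF measurable_snd this]
  have "snd \<in> measurable ((borel :: (nat \<Rightarrow> complex) measure) \<Otimes>\<^sub>M unit_interval) borel" .
  then have "(\<lambda>p :: (nat \<Rightarrow> complex) \<times> real. (fst p, snd p)) \<in> measurable (borel \<Otimes>\<^sub>M unit_interval) (borel \<Otimes>\<^sub>M borel)"
    by (intro measurable_Pair measurable_fst)
  then have "(\<lambda>p :: (nat \<Rightarrow> complex) \<times> real. (fst p, snd p)) \<in> measurable (borel \<Otimes>\<^sub>M unit_interval) borel"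
    unfolding borel_prod .
  from measurable_compose[OF this 1] show ?thesis by simp
qed

lemma measurable_torus_mean:
  assumes "F \<in> borel_measurable borel"
  shows "torus_mean n F \<in> borel_measurable borel"
proof (induction n)
  case 0
  have "torus_mean 0 F = F" by (rule ext) simp
  then show ?case using assms by simp
next
  case (Suc n)
  interpret finite_measure unit_interval
    by (rule finite_measureI) (simp add: emeasure_unit_interval)
  have "(\<lambda>x. \<integral>\<^sup>+s. torus_mean n F (x(n := cis (2 * pi * s))) \<partial>unit_interval) \<in> borel_measurable borel"
    by (rule borel_measurable_nn_integral)
       (simp only: case_prod_unfold measurable_fun_upd_cis[OF Suc])
  moreover have "torus_mean (Suc n) F = (\<lambda>x. \<integral>\<^sup>+s. torus_mean n F (x(n := cis (2 * pi * s))) \<partial>unit_interval)"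
    by (rule ext) simp
  ultimately show ?case by simp
qed

lemma measurable_fun_upd_cis_section:
  fixes F :: "(nat \<Rightarrow> complex) \<Rightarrow> ennreal"
  assumes "F \<in> borel_measurable borel"
  shows "(\<lambda>s. F (x(n := cis (2 * pi * s)))) \<in> borel_measurable unit_interval"
proof -
  have "(\<lambda>s. (x, s)) \<in> measurable unit_interval (borel \<Otimes>\<^sub>M unit_interval)"
    by (rule measurable_Pair1') simp
  from measurable_compose[OF this measurable_fun_upd_cis[OF assms]]
  show ?thesis by simp
qed

lemma torus_mean_Fatou:
  assumes "\<And>k. F k \<in> borel_measurable borel"
  shows "torus_mean n (\<lambda>x. liminf (\<lambda>k. F k x)) x \<le> liminf (\<lambda>k. torus_mean n (F k) x)"
proof (induction n arbitrary: x)
  case (Suc n)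
  have "torus_mean (Suc n) (\<lambda>x. liminf (\<lambda>k. F k x)) x
      \<le> (\<integral>\<^sup>+s. liminf (\<lambda>k. torus_mean n (F k) (x(n := cis (2 * pi * s)))) \<partial>unit_interval)"
    unfolding torus_mean.simps by (intro nn_integral_mono Suc)
  also have "\<dots> \<le> liminf (\<lambda>k. \<integral>\<^sup>+s. torus_mean n (F k) (x(n := cis (2 * pi * s))) \<partial>unit_interval)"
    by (intro nn_integral_liminf measurable_fun_upd_cis_section measurable_torus_mean assms)
  finally show ?case by simp
qed simp

text \<open>The base points may differ below n because those entries are overwritten. The functions
  are compared on the torus only, where the limits below are controlled.\<close>

lemma torus_mean_mono:
  assumes "\<And>i. n \<le> i \<Longrightarrow> x i = x' i"
    and "\<And>b. (\<And>i. i < n \<Longrightarrow> norm (b i) = 1) \<Longrightarrow> (\<And>i. n \<le> i \<Longrightarrow> b i = x i) \<Longrightarrow> F b \<le> G b"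
  shows "torus_mean n F x \<le> torus_mean n G x'"
  using assms
proof (induction n arbitrary: x x')
  case 0
  then have "x = x'" by auto
  then show ?case using 0 by simp
next
  case (Suc n)
  show ?case unfolding torus_mean.simps
  proof (intro nn_integral_mono Suc.IH)
    fix s i assume "n \<le> i"
    then show "(x(n := cis (2 * pi * s))) i = (x'(n := cis (2 * pi * s))) i"
      using Suc.prems(1) by (cases "i = n") auto
  next
    fix s b assume b: "\<And>i. i < n \<Longrightarrow> norm (b i) = 1" "\<And>i. n \<le> i \<Longrightarrow> b i = (x(n := cis (2 * pi * s))) i"
    show "F b \<le> G b"
    proof (rule Suc.prems(2))
      show "norm (b i) = 1" if "i < Suc n" for i using b that by (cases "i = n") auto
      show "b i = x i" if "Suc n \<le> i" for i using b(2)[of i] that by auto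
    qed
  qed
qed

lemma torus_mean_const: "torus_mean n (\<lambda>_. c) x = c"
proof (induction n arbitrary: x)
  case (Suc n)
  then show ?case by (simp add: emeasure_unit_interval)
qed simp

text \<open>The highest coordinate is moved to the circle first, the lower ones keeping norm at most
  t. So \<open>step\<close> demands norm at most t of the averaged coordinate and at most 1 of the
  others, some of which already lie on the circle.\<close>

lemma torus_mean_le_power_mult:
  assumes F: "F \<in> borel_measurable borel"
    and step: "\<And>y i. i < N \<Longrightarrow> y \<in> cspace N \<Longrightarrow> (\<And>k. k < N \<Longrightarrow> norm (y k) \<le> 1) \<Longrightarrow> norm (y i) \<le> t \<Longrightarrow>
      (\<integral>\<^sup>+s. F (y(i := cis (2 * pi * s))) \<partial>unit_interval) \<le> C * F y"
    and x: "x \<in> cspace N" "\<And>i. i < N \<Longrightarrow> norm (x i) \<le> 1" "\<And>i. i < n \<Longrightarrow> norm (x i) \<le> t" and n: "n \<le> N"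
  shows "torus_mean n F x \<le> C ^ n * F x"
  using x n
proof (induction n arbitrary: x)
  case (Suc n)
  have "torus_mean (Suc n) F x \<le> (\<integral>\<^sup>+s. C ^ n * F (x(n := cis (2 * pi * s))) \<partial>unit_interval)"
    unfolding torus_mean.simps
  proof (intro nn_integral_mono Suc.IH)
    fix s
    show "x(n := cis (2 * pi * s)) \<in> cspace N"
      using fun_upd_in_cspace Suc.prems by simp
  qed (use Suc.prems in auto)
  also have "\<dots> = C ^ n * (\<integral>\<^sup>+s. F (x(n := cis (2 * pi * s))) \<partial>unit_interval)"
    by (intro nn_integral_cmult measurable_fun_upd_cis_section F)
  also have "\<dots> \<le> C ^ n * (C * F x)"
    using Suc.prems by (intro mult_left_mono step) auto
  finally show ?case by (simp add: mult_ac)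
qed simp

subsection \<open>The regularization is a minorant\<close>

text \<open>Cutting off at N puts the value into \<open>cspace N\<close> for every b, so that
  measurability can be asserted on the whole function space.\<close>

definition torus_point :: "nat \<Rightarrow> (nat \<Rightarrow> complex) \<Rightarrow> real \<Rightarrow> (nat \<Rightarrow> complex) \<Rightarrow> nat \<Rightarrow> complex" where
  "torus_point N z \<rho> b = (\<lambda>i. if i < N then z i + of_real \<rho> * b i else 0)"

lemma torus_point_in_cspace: "torus_point N z \<rho> b \<in> cspace N"
  by (simp add: torus_point_def cspace_def)

lemma torus_point_in_polydisc:
  assumes "\<And>i. i < N \<Longrightarrow> norm (b i) \<le> 1" "0 < \<rho>" "\<rho> < R"
  shows "torus_point N z \<rho> b \<in> polydisc N z R"
proof -
  have "\<rho> * norm (b i) < R" if "i < N" for i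
    using mult_left_mono[OF assms(1)[OF that], of \<rho>] assms(2,3) by linarith
  then show ?thesis
    using torus_point_in_cspace assms(2) by (simp add: polydisc_def torus_point_def dist_norm norm_mult)
qed

lemma continuous_on_torus_point: "continuous_on UNIV (torus_point N z \<rho>)"
proof (rule continuous_on_coordinatewise_then_product)
  fix i show "continuous_on UNIV (\<lambda>b. torus_point N z \<rho> b i)"
    by (cases "i < N") (simp_all add: torus_point_def continuous_intros)
qed

text \<open>Off \<open>\<Omega>\<close>, where \<open>v\<close> is arbitrary, the gap is set to \<open>e2ennreal (-\<infinity>) = 0\<close>.\<close>
definition gap :: "(nat \<Rightarrow> complex) set \<Rightarrow> real \<Rightarrow> ((nat \<Rightarrow> complex) \<Rightarrow> ereal) \<Rightarrow> (nat \<Rightarrow> complex) \<Rightarrow> ennreal" where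
  "gap \<Omega> K v y = e2ennreal (ereal K - (if y \<in> \<Omega> then v y else \<infinity>))"

lemma gap_ge:
  assumes "0 \<le> r" "y \<in> \<Omega>" "v y \<le> ereal (K - r)"
  shows "ennreal r \<le> gap \<Omega> K v y"
proof -
  have "ereal (K - r) \<le> ereal K" using assms(1) by simp
  then have "v y \<le> ereal K" using assms(3) order_trans by blast
  then show ?thesis using assms by (simp add: gap_def ennreal_le_e2ennreal_iff)
qed

lemma gap_le: "0 \<le> r \<Longrightarrow> y \<in> \<Omega> \<Longrightarrow> ereal (K - r) \<le> v y \<Longrightarrow> gap \<Omega> K v y \<le> ennreal r"
  unfolding gap_def by (cases "v y") (auto simp: e2ennreal_ereal e2ennreal_neg intro!: ennreal_leI)

text \<open>With the value \<infinity> off the open set \<Omega>, strict sublevel sets are open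
  after composition with \<tau>, and open sets are Borel.\<close>

lemma measurable_gap:
  assumes \<Omega>: "copen N \<Omega>" and usc: "usc_on \<Omega> v"
    and \<tau>: "continuous_on UNIV \<tau>" "\<And>b. \<tau> b \<in> cspace N"
  shows "(\<lambda>b. gap \<Omega> K v (\<tau> b)) \<in> borel_measurable borel"
proof -
  obtain T where T: "open T" "\<Omega> = cspace N \<inter> T" using copen_eq_Int[OF \<Omega>] by blast
  have mem: "\<tau> b \<in> \<Omega> \<longleftrightarrow> \<tau> b \<in> T" for b using T(2) \<tau>(2) by blast
  have "(\<lambda>b. if \<tau> b \<in> \<Omega> then v (\<tau> b) else \<infinity>) \<in> borel_measurable borel"
  proof (rule borel_measurableI_less)
    fix c
    have "open {b. (if \<tau> b \<in> \<Omega> then v (\<tau> b) else \<infinity>) < c}"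
    proof (subst open_subopen, intro ballI)
      fix b assume "b \<in> {b. (if \<tau> b \<in> \<Omega> then v (\<tau> b) else \<infinity>) < c}"
      then have b: "\<tau> b \<in> \<Omega>" "v (\<tau> b) < c" by (auto split: if_splits)
      then obtain T' where T': "open T'" "\<tau> b \<in> T'" "\<forall>y\<in>\<Omega> \<inter> T'. v y < c"
        using usc unfolding usc_on_def by metis
      have "open (\<tau> -` (T \<inter> T'))" using T(1) T'(1) \<tau>(1) by (intro open_vimage) auto
      moreover have "\<tau> -` (T \<inter> T') \<subseteq> {b. (if \<tau> b \<in> \<Omega> then v (\<tau> b) else \<infinity>) < c}"
        using T'(3) mem by auto
      ultimately show "\<exists>A. open A \<and> b \<in> A \<and> A \<subseteq> {b. (if \<tau> b \<in> \<Omega> then v (\<tau> b) else \<infinity>) < c}"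
        using b(1) T'(2) mem by (intro exI[of _ "\<tau> -` (T \<inter> T')"]) auto
    qed
    then show "{b \<in> space borel. (if \<tau> b \<in> \<Omega> then v (\<tau> b) else \<infinity>) < c} \<in> sets borel" by simp
  qed
  then show ?thesis unfolding gap_def
    by (intro measurable_compose[OF _ measurable_e2ennreal] borel_measurable_ereal_diff) auto
qed

lemma torus_mean_gap_le:
  assumes \<Omega>: "copen N \<Omega>" and v: "psh_on N \<Omega> v"
    and R: "polydisc N z R \<subseteq> \<Omega>" "\<And>y. y \<in> polydisc N z R \<Longrightarrow> v y \<le> ereal K"
    and z: "z \<in> cspace N" and \<rho>: "0 < \<rho>" "\<rho> < R" and t: "0 \<le> t" "t < 1"
    and y: "y \<in> cspace N" "\<And>i. i < N \<Longrightarrow> dist (y i) (z i) \<le> t * \<rho>"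
  shows "torus_mean N (\<lambda>b. gap \<Omega> K v (torus_point N z \<rho> b)) (\<lambda>_. 0)
      \<le> ennreal ((1 + t) / (1 - t)) ^ N * gap \<Omega> K v y"
proof -
  define F where "F = (\<lambda>b. gap \<Omega> K v (torus_point N z \<rho> b))"
  define x where "x i = (y i - z i) / of_real \<rho>" for i
  have usc: "usc_on \<Omega> v" and line: "line_subharmonic N \<Omega> v" using v by (auto simp: psh_on_def)
  have x: "x \<in> cspace N" using y(1) z by (auto simp: x_def cspace_def)
  have xt: "norm (x i) \<le> t" if "i < N" for i
    using y(2)[OF that] \<rho>(1) by (simp add: x_def norm_divide dist_norm field_simps)
  have yx: "torus_point N z \<rho> x = y"
    using \<rho>(1) y(1) by (auto simp: torus_point_def x_def cspace_def fun_eq_iff)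
  have F: "F \<in> borel_measurable borel"
    unfolding F_def by (rule measurable_gap[OF \<Omega> usc continuous_on_torus_point torus_point_in_cspace])
  have step: "(\<integral>\<^sup>+s. F (w(i := cis (2 * pi * s))) \<partial>unit_interval) \<le> ennreal ((1 + t) / (1 - t)) * F w"
    if i: "i < N" and w: "w \<in> cspace N" "\<And>k. k < N \<Longrightarrow> norm (w k) \<le> 1" "norm (w i) \<le> t" for w i
  proof -
    define q where "q = torus_point N z \<rho> w"
    have qR: "q \<in> polydisc N z R" unfolding q_def by (rule torus_point_in_polydisc[OF w(2) \<rho>])
    have qc: "q \<in> cspace N" using qR polydisc_subset_cspace by blast
    have upd: "torus_point N z \<rho> (w(i := c)) = q(i := z i + of_real \<rho> * c)" for c
      using i by (auto simp: torus_point_def q_def)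
    have in_R: "q(i := l) \<in> polydisc N z R" if "l \<in> cball (z i) \<rho>" for l
      using qR that \<rho> i fun_upd_in_cspace[OF qc i] by (auto simp: polydisc_def dist_commute)
    have on_circle: "z i + of_real \<rho> * cis s \<in> cball (z i) \<rho>" for s
      using \<rho> by (simp add: dist_norm norm_mult)
    have "F (w(i := cis s)) = e2ennreal (ereal K - v (q(i := z i + of_real \<rho> * cis s)))" for s
      using in_R[OF on_circle] R(1) by (auto simp: F_def gap_def upd)
    then have "(\<integral>\<^sup>+s. F (w(i := cis (2 * pi * s))) \<partial>unit_interval)
        = (\<integral>\<^sup>+s. e2ennreal (ereal K - v (q(i := z i + of_real \<rho> * cis (2 * pi * s)))) \<partial>unit_interval)"
      by simp
    also have "\<dots> \<le> ennreal ((1 + t) / (1 - t)) * e2ennreal (ereal K - v (q(i := q i)))"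
    proof (rule subharmonic_Harnack[OF line_subharmonic_coordinate[OF line qc i] _ \<rho>(1) _ t(2)])
      show "cball (z i) \<rho> \<subseteq> {l. q(i := l) \<in> \<Omega>}" using in_R R(1) by blast
      show "dist (q i) (z i) \<le> t * \<rho>"
        using i w(3) \<rho>(1) by (simp add: q_def torus_point_def dist_norm norm_mult mult.commute)
      show "v (q(i := l)) \<le> ereal K" if "l \<in> cball (z i) \<rho>" for l using R(2) in_R[OF that] .
    qed
    also have "e2ennreal (ereal K - v (q(i := q i))) = F w"
      using qR R(1) by (auto simp: F_def gap_def q_def)
    finally show ?thesis .
  qed
  \<comment> \<open>Both base points vanish from N on and their other entries are overwritten, so
    the mean may be started at the rescaled y.\<close>
  have "torus_mean N F (\<lambda>_. 0) \<le> torus_mean N F x"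
    using x by (intro torus_mean_mono) (auto simp: cspace_def)
  also have "\<dots> \<le> ennreal ((1 + t) / (1 - t)) ^ N * F x"
  proof (rule torus_mean_le_power_mult[OF F step x])
    show "norm (x i) \<le> 1" if "i < N" for i using xt[OF that] t by linarith
  qed (use xt in auto)
  finally show ?thesis by (simp add: F_def yx)
qed

lemma usc_reg_SUP_le:
  assumes \<Omega>: "copen N \<Omega>" and u: "line_subharmonic N \<Omega> u"
    and U: "\<And>v. v \<in> \<U> \<Longrightarrow> psh_on N \<Omega> v" "\<And>v x. v \<in> \<U> \<Longrightarrow> x \<in> \<Omega> \<Longrightarrow> v x \<le> u x"
    and R: "0 < R" "polydisc N z R \<subseteq> \<Omega>" "\<And>v y. v \<in> \<U> \<Longrightarrow> y \<in> polydisc N z R \<Longrightarrow> v y \<le> ereal K0"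
    and z: "z \<in> \<Omega>"
  shows "usc_reg N \<Omega> (\<lambda>z. SUP v\<in>\<U>. v z) z \<le> u z"
proof (rule ccontr)
  assume "\<not> ?thesis"
  then have "u z < usc_reg N \<Omega> (\<lambda>z. SUP v\<in>\<U>. v z) z" by simp
  then obtain c where c: "u z < ereal c" "ereal c < usc_reg N \<Omega> (\<lambda>z. SUP v\<in>\<U>. v z) z"
    using ereal_dense2 by blast
  \<comment> \<open>Room between u z and c: the limit will give K - c' \<le> K - c, which is
    absurd.\<close>
  obtain c' where c': "u z < ereal c'" "c' < c" using ereal_dense2[OF c(1)] by auto
  \<comment> \<open>The maximum makes K - c nonnegative, so \<open>ennreal\<close> does not clip
    it.\<close>
  define K where "K = max K0 c"
  have K: "v y \<le> ereal K" if "v \<in> \<U>" "y \<in> polydisc N z R" for v y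
    using R(3)[OF that] order_trans by (fastforce simp: K_def)
  have Kc: "0 \<le> K - c" "0 \<le> K - c'" using c'(2) by (auto simp: K_def)
  have zc: "z \<in> cspace N" using z copen_subset_cspace[OF \<Omega>] by blast
  define \<epsilon> where "\<epsilon> j = inverse (real (Suc j))" for j
  have \<epsilon>: "\<epsilon> j > 0" for j by (simp add: \<epsilon>_def)
  have \<epsilon>0: "\<epsilon> \<longlonglongrightarrow> 0" unfolding \<epsilon>_def by (rule LIMSEQ_inverse_real_of_nat)
  have "\<exists>y v. y \<in> \<Omega> \<inter> polydisc N z (\<epsilon> j) \<and> v \<in> \<U> \<and> ereal c < v y" for j
  proof -
    have "ereal c < (SUP y\<in>\<Omega> \<inter> polydisc N z (\<epsilon> j). SUP v\<in>\<U>. v y)"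
      using c(2) usc_reg_le_SUP[OF \<epsilon>] by (rule order_less_le_trans)
    then show ?thesis by (auto simp: less_SUP_iff)
  qed
  then obtain y v where yv: "\<And>j. y j \<in> \<Omega> \<inter> polydisc N z (\<epsilon> j)" "\<And>j. v j \<in> \<U>" "\<And>j. ereal c < v j (y j)"
    by metis
  \<comment> \<open>A single function below every K - v j, so its mean inherits the bound for each
    j; on \<Omega> it is at least K - u because v j \<le> u.\<close>
  define G where "G \<rho> b = (INF j. gap \<Omega> K (v j) (torus_point N z \<rho> b))" for \<rho> b
  have meas: "G \<rho> \<in> borel_measurable borel" for \<rho>
    unfolding G_def
    by (intro borel_measurable_INF measurable_gap[OF \<Omega> _ continuous_on_torus_point torus_point_in_cspace])
       (use U(1) yv(2) in \<open>auto simp: psh_on_def\<close>)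
  have mean_le: "torus_mean N (G \<rho>) (\<lambda>_. 0) \<le> ennreal (K - c)" if \<rho>: "0 < \<rho>" "\<rho> < R" for \<rho>
  proof -
    \<comment> \<open>The displacement of y j from z in units of \<rho>. The limit in j is taken
      with \<rho> fixed; \<rho> shrinks only afterwards.\<close>
    define t where "t j = \<epsilon> j / \<rho>" for j
    have t0: "t \<longlonglongrightarrow> 0" unfolding t_def using tendsto_divide[OF \<epsilon>0 tendsto_const] \<rho> by force
    have "(\<lambda>j. ((1 + t j) / (1 - t j)) ^ N * (K - c)) \<longlonglongrightarrow> ((1 + 0) / (1 - 0)) ^ N * (K - c)"
      by (intro tendsto_intros t0) simp
    then have lim: "(\<lambda>j. ennreal (((1 + t j) / (1 - t j)) ^ N * (K - c))) \<longlonglongrightarrow> ennreal (K - c)"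
      by (intro tendsto_ennrealI) simp
    have "\<forall>\<^sub>F j in sequentially. t j < 1" using t0 by (rule order_tendstoD) simp
    then have "\<forall>\<^sub>F j in sequentially. torus_mean N (G \<rho>) (\<lambda>_. 0) \<le> ennreal (((1 + t j) / (1 - t j)) ^ N * (K - c))"
    proof eventually_elim
      case (elim j)
      have tj: "0 \<le> t j" using \<epsilon>[of j] \<rho> by (simp add: t_def)
      have y: "y j \<in> cspace N" "y j \<in> \<Omega>" using yv(1)[of j] by (auto simp: polydisc_def)
      have yt: "dist (y j i) (z i) \<le> t j * \<rho>" if "i < N" for i
        using yv(1)[of j] that \<rho>(1) by (auto simp: polydisc_def t_def less_imp_le)
      have "torus_mean N (G \<rho>) (\<lambda>_. 0)
          \<le> torus_mean N (\<lambda>b. gap \<Omega> K (v j) (torus_point N z \<rho> b)) (\<lambda>_. 0)"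
        unfolding G_def by (intro torus_mean_mono INF_lower) auto
      also have "\<dots> \<le> ennreal ((1 + t j) / (1 - t j)) ^ N * gap \<Omega> K (v j) (y j)"
        by (rule torus_mean_gap_le[OF \<Omega> U(1)[OF yv(2)] R(2) K[OF yv(2)] zc \<rho> tj elim y(1) yt])
      also have "\<dots> \<le> ennreal ((1 + t j) / (1 - t j)) ^ N * ennreal (K - c)"
        using yv(3)[of j] Kc(1) y(2) by (intro mult_left_mono gap_le) auto
      also have "\<dots> = ennreal (((1 + t j) / (1 - t j)) ^ N * (K - c))"
        using tj elim Kc(1) by (simp add: ennreal_mult ennreal_power)
      finally show ?case .
    qed
    then show ?thesis by (intro tendsto_lowerbound[OF lim]) auto
  qed
  define \<rho> where "\<rho> k = R / 2 * \<epsilon> k" for k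
  have \<rho>: "0 < \<rho> k" "\<rho> k < R" for k
  proof -
    show "0 < \<rho> k" using R(1) \<epsilon> by (simp add: \<rho>_def)
    have "\<epsilon> k \<le> 1" by (simp add: \<epsilon>_def inverse_le_1_iff)
    then have "R / 2 * \<epsilon> k \<le> R / 2 * 1" using R(1) by (intro mult_left_mono) auto
    then show "\<rho> k < R" using R(1) by (simp add: \<rho>_def)
  qed
  have \<rho>0: "\<rho> \<longlonglongrightarrow> 0" unfolding \<rho>_def using tendsto_mult[OF tendsto_const \<epsilon>0] by force
  have "ennreal (K - c') \<le> liminf (\<lambda>k. G (\<rho> k) b)"
    if b: "\<And>i. i < N \<Longrightarrow> norm (b i) = 1" "\<And>i. N \<le> i \<Longrightarrow> b i = 0" for b
  proof (rule Liminf_bounded)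
    have bc: "b \<in> cspace N" using b(2) by (simp add: cspace_def)
    \<comment> \<open>All radii give points of one complex line through z, along which u is upper
      semicontinuous.\<close>
    have tp: "torus_point N z r b = cline z b (of_real r)" for r
      using b(2) zc by (auto simp: torus_point_def cline_def cspace_def fun_eq_iff)
    have "\<forall>\<^sub>F k in sequentially. cline z b (of_real (\<rho> k)) \<in> \<Omega> \<longrightarrow> u (cline z b (of_real (\<rho> k))) < ereal c'"
    proof (cases "b = (\<lambda>_. 0)")
      \<comment> \<open>This happens only for N = 0, where b spans no line and every point is
        z.\<close>
      case True
      then show ?thesis using c'(1) by (simp add: cline_def)
    next
      case False
      have "usc_on {l. cline z b l \<in> \<Omega>} (\<lambda>l. u (cline z b l))"
        using u zc bc False unfolding line_subharmonic_def subharmonic_on_def by blast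
      moreover have "cline z b 0 = z" by (simp add: cline_def)
      ultimately obtain T where T: "open T" "0 \<in> T" "\<forall>l\<in>{l. cline z b l \<in> \<Omega>} \<inter> T. u (cline z b l) < ereal c'"
        using z c'(1) unfolding usc_on_def by (metis (mono_tags, lifting) mem_Collect_eq)
      have "(\<lambda>k. complex_of_real (\<rho> k)) \<longlonglongrightarrow> of_real 0" by (rule tendsto_of_real[OF \<rho>0])
      then have "\<forall>\<^sub>F k in sequentially. complex_of_real (\<rho> k) \<in> T"
        using T(1,2) by (intro topological_tendstoD) auto
      then show ?thesis by eventually_elim (use T(3) in blast)
    qed
    then show "\<forall>\<^sub>F k in sequentially. ennreal (K - c') \<le> G (\<rho> k) b"
    proof eventually_elim
      case (elim k)
      have "torus_point N z (\<rho> k) b \<in> polydisc N z R"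
        using b(1) by (intro torus_point_in_polydisc \<rho>) simp
      then have in\<Omega>: "torus_point N z (\<rho> k) b \<in> \<Omega>" using R(2) by blast
      show ?case unfolding G_def
      proof (intro INF_greatest gap_ge Kc(2) in\<Omega>)
        fix j
        have "v j (torus_point N z (\<rho> k) b) \<le> u (torus_point N z (\<rho> k) b)" by (rule U(2)[OF yv(2) in\<Omega>])
        also have "\<dots> \<le> ereal c'" using elim in\<Omega> unfolding tp by simp
        finally show "v j (torus_point N z (\<rho> k) b) \<le> ereal (K - (K - c'))" by simp
      qed
    qed
  qed
  then have "torus_mean N (\<lambda>_. ennreal (K - c')) (\<lambda>_. 0) \<le> torus_mean N (\<lambda>b. liminf (\<lambda>k. G (\<rho> k) b)) (\<lambda>_. 0)"
    by (intro torus_mean_mono) auto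
  also have "\<dots> \<le> liminf (\<lambda>k. torus_mean N (G (\<rho> k)) (\<lambda>_. 0))"
    by (rule torus_mean_Fatou[OF meas])
  also have "\<dots> \<le> ennreal (K - c)"
    by (intro Liminf_le always_eventually allI mean_le \<rho>) simp
  finally have "ennreal (K - c') \<le> ennreal (K - c)" unfolding torus_mean_const .
  then show False using Kc(1) c'(2) by (simp add: ennreal_le_iff)
qed

theorem theorem4p3:
  fixes N :: nat and \<Omega> :: "(nat \<Rightarrow> complex) set" and u :: "(nat \<Rightarrow> complex) \<Rightarrow> ereal"
  assumes P: statement_P
    and \<Omega>: "copen N \<Omega>"
    and u_fin: "\<forall>z\<in>\<Omega>. u z < \<infinity>"
    and u_lines: "line_subharmonic N \<Omega> u"
  shows "psh_on N \<Omega> (\<lambda>z. SUP v \<in> {v. psh_on N \<Omega> v \<and> (\<forall>x\<in>\<Omega>. v x \<le> u x)}. v z)"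
proof -
  define \<U> where "\<U> = {v. psh_on N \<Omega> v \<and> (\<forall>x\<in>\<Omega>. v x \<le> u x)}"
  define s where "s = (\<lambda>z. SUP v\<in>\<U>. v z)"
  have U: "psh_on N \<Omega> v" "\<And>x. x \<in> \<Omega> \<Longrightarrow> v x \<le> u x" if "v \<in> \<U>" for v
    using that by (auto simp: \<U>_def)
  have bdd: "\<exists>R>0. polydisc N z R \<subseteq> \<Omega> \<and> (\<exists>K::real. \<forall>v\<in>\<U>. \<forall>y\<in>polydisc N z R. v y \<le> ereal K)"
    if "z \<in> \<Omega>" for z
    by (rule psh_minorants_bdd_above_polydisc[OF P \<Omega> u_fin u_lines _ _ that]) (use U in auto)
  have "psh_on N \<Omega> (usc_reg N \<Omega> s)"
    unfolding s_def
  proof (rule psh_on_usc_reg_SUP[OF \<Omega> U(1)])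
    fix z assume "z \<in> \<Omega>"
    then show "\<exists>R>0. \<exists>K::real. \<forall>v\<in>\<U>. \<forall>y\<in>\<Omega> \<inter> polydisc N z R. v y \<le> ereal K"
      using bdd by (meson IntD2)
  qed
  moreover have "usc_reg N \<Omega> s z \<le> u z" if z: "z \<in> \<Omega>" for z
  proof -
    obtain R K where R: "R > 0" "polydisc N z R \<subseteq> \<Omega>"
      "\<And>v y. v \<in> \<U> \<Longrightarrow> y \<in> polydisc N z R \<Longrightarrow> v y \<le> ereal K"
      using bdd[OF z] by blast
    show ?thesis unfolding s_def
      by (rule usc_reg_SUP_le[OF \<Omega> u_lines _ _ R(1,2) _ z]) (use U R(3) in auto)
  qed
  ultimately have "usc_reg N \<Omega> s \<in> \<U>" by (simp add: \<U>_def)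
  then have "usc_reg N \<Omega> s z \<le> s z" for z unfolding s_def by (rule SUP_upper)
  then have "usc_reg N \<Omega> s z = s z" if "z \<in> \<Omega>" for z
    using usc_reg_ge[OF that copen_subset_cspace[OF \<Omega>]] by (simp add: order_antisym)
  with \<open>psh_on N \<Omega> (usc_reg N \<Omega> s)\<close> have "psh_on N \<Omega> s" by (rule psh_on_cong)
  then show ?thesis by (simp add: s_def \<U>_def)
qed

end
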